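(* Let $n\ge2$, $t\in(0,1)$, and let $A_1,\dots,A_n$ be positive invertible operators on a Hilbert space $\mathcal{H}$ with $mI\le A_i\le MI$ for all $i$ and some scalars $0<m<M$. Then for $p\ge2$, \[ A[n,t](A_1,\dots,A_n)^p\le \frac{(m+M)^{2p}}{16m^pM^p}G[n,t](A_1,\dots,A_n)^p. \]
   Context: For positive invertible $A,B$ and $t\in(0,1)$, $A\sharp_tB:=A^{1/2}(A^{-1/2}BA^{-1/2})^tA^{1/2}$. Lawson–Lim weighted geometric mean: $G[2,t](A_1,A_2)=A_1\sharp_tA_2$; for $n\ge3$, put $A_i^{(0)}=A_i$ and $A_i^{(r)}=G[n-1,t]\big(A_1^{(r-1)},\dots,A_{i-1}^{(r-1)},A_{i+1}^{(r-1)},\dots,A_n^{(r-1)}\big)$; the sequences $(A_i^{(r)})_r$ converge (in the Thompson metric) to a common limit, defined to be $G[n,t](A_1,\dots,A_n)$. The weighted arithmetic mean $A[n,t]$ is defined by the same recursion starting from $A[2,t](A_1,A_2)=(1-t)A_1+tA_2$; it has the form $A[n,t](A_1,\dots,A_n)=\sum_{i=1}^n t[n]_iA_i$ with coefficients $t[n]_i\ge0$, $\sum_it[n]_i=1$, depending only on $n$ and $t$. *)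

theory Defs
  imports "HOL-Analysis.Analysis" "HOL-Computational_Algebra.Polynomial"
begin

type_synonym 'a op = "'a \<Rightarrow>\<^sub>L 'a"

definition self_adjoint :: "'a::{real_inner,complete_space} op \<Rightarrow> bool" where
  "self_adjoint T \<longleftrightarrow> (\<forall>x y. inner (T x) y = inner x (T y))"

definition positive_op :: "'a::{real_inner,complete_space} op \<Rightarrow> bool" where
  "positive_op T \<longleftrightarrow> self_adjoint T \<and> (\<forall>x. 0 \<le> inner (T x) x)"

definition loewner :: "'a::{real_inner,complete_space} op \<Rightarrow> 'a op \<Rightarrow> bool" where
  "loewner A B \<longleftrightarrow> positive_op (B - A)"

definition invertible_op :: "'a::{real_inner,complete_space} op \<Rightarrow> bool" where
  "invertible_op A \<longleftrightarrow> (\<exists>B. A o\<^sub>L B = id_blinfun \<and> B o\<^sub>L A = id_blinfun)"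

definition posinv :: "'a::{real_inner,complete_space} op \<Rightarrow> bool" where
  "posinv A \<longleftrightarrow> positive_op A \<and> invertible_op A"

definition op_power :: "'a::{real_inner,complete_space} op \<Rightarrow> nat \<Rightarrow> 'a op" where
  "op_power X k = ((\<lambda>Y. X o\<^sub>L Y) ^^ k) id_blinfun"

definition polyop :: "real poly \<Rightarrow> 'a::{real_inner,complete_space} op \<Rightarrow> 'a op" where
  "polyop q X = (\<Sum>i\<le>degree q. coeff q i *\<^sub>R op_power X i)"

text \<open>Continuous functional calculus for self-adjoint operators: f(X) is the norm
  limit of q_k(X) for any sequence of polynomials q_k converging uniformly to f on an
  interval [a,b] with a I \<le> X \<le> b I.\<close>
definition cfun :: "(real \<Rightarrow> real) \<Rightarrow> 'a::{real_inner,complete_space} op \<Rightarrow> 'a op" where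
  "cfun f X = (THE Y. \<forall>a b (q :: nat \<Rightarrow> real poly).
      loewner (a *\<^sub>R id_blinfun) X \<and> loewner X (b *\<^sub>R id_blinfun) \<and>
      uniform_limit {a..b} (\<lambda>k x. poly (q k) x) f sequentially
      \<longrightarrow> ((\<lambda>k. polyop (q k) X) \<longlonglongrightarrow> Y))"

definition opow :: "'a::{real_inner,complete_space} op \<Rightarrow> real \<Rightarrow> 'a op" where
  "opow X r = cfun (\<lambda>x. x powr r) X"

definition sharp :: "real \<Rightarrow> 'a::{real_inner,complete_space} op \<Rightarrow> 'a op \<Rightarrow> 'a op" where
  "sharp t A B = opow A (1/2) o\<^sub>L
      opow (opow A (-1/2) o\<^sub>L B o\<^sub>L opow A (-1/2)) t o\<^sub>L opow A (1/2)"

definition wam2 :: "real \<Rightarrow> 'a::{real_inner,complete_space} op \<Rightarrow> 'a op \<Rightarrow> 'a op" where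
  "wam2 t A B = (1 - t) *\<^sub>R A + t *\<^sub>R B"

definition Mop :: "'a::{real_inner,complete_space} op \<Rightarrow> 'a op \<Rightarrow> real" where
  "Mop A B = Inf {c. 0 < c \<and> loewner A (c *\<^sub>R B)}"

definition thompson :: "'a::{real_inner,complete_space} op \<Rightarrow> 'a op \<Rightarrow> real" where
  "thompson A B = max (ln (Mop A B)) (ln (Mop B A))"

definition drop_nth :: "nat \<Rightarrow> 'b list \<Rightarrow> 'b list" where
  "drop_nth i xs = take i xs @ drop (Suc i) xs"

text \<open>Lawson--Lim recursion. llrec base t k is the mean of (k+2) operators
  (given as a list of length k+2), built from the two-variable mean base t.\<close>
primrec llrec :: "(real \<Rightarrow> 'a::{real_inner,complete_space} op \<Rightarrow> 'a op \<Rightarrow> 'a op)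
    \<Rightarrow> real \<Rightarrow> nat \<Rightarrow> 'a op list \<Rightarrow> 'a op" where
  "llrec base t 0 = (\<lambda>As. base t (As ! 0) (As ! 1))"
| "llrec base t (Suc k) = (\<lambda>As.
     let step = (\<lambda>Bs. map (\<lambda>i. llrec base t k (drop_nth i Bs)) [0..<length Bs])
     in THE L. posinv L \<and>
        (\<forall>i<length As. ((\<lambda>r. thompson (((step ^^ r) As) ! i) L) \<longlonglongrightarrow> 0)))"

definition GM :: "real \<Rightarrow> 'a::{real_inner,complete_space} op list \<Rightarrow> 'a op" where
  "GM t As = llrec sharp t (length As - 2) As"

definition AM :: "real \<Rightarrow> 'a::{real_inner,complete_space} op list \<Rightarrow> 'a op" where
  "AM t As = llrec wam2 t (length As - 2) As"

end

theory Submission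
  imports Defs "HOL-Library.NList"
begin

text \<open>
  Write \<open>X = A[n,t](A\<^sub>1,\<dots>,A\<^sub>n)\<close> and \<open>G = G[n,t](A\<^sub>1,\<dots>,A\<^sub>n)\<close>. The inequality
  \<open>X + mM G\<^sup>-\<^sup>1 \<le> m + M\<close> holds for a single operator (\<open>X = G = A\<^sub>i\<close>) since
  \<open>(x - m)(x - M) \<le> 0\<close> on \<open>[m,M]\<close>, is inherited by the two-variable means because
  \<open>(A \<sharp>\<^sub>t B)\<^sup>-\<^sup>1 \<le> (1-t) A\<^sup>-\<^sup>1 + t B\<^sup>-\<^sup>1\<close>, and survives the limits of the recursion. With \<open>s = p/2 \<ge> 1\<close>
  it gives \<open>X\<^sup>s + (mM)\<^sup>s G\<^sup>-\<^sup>s \<le> (m + M)\<^sup>s\<close>, as \<open>x\<^sup>s \<le> (m+M)\<^sup>s\<^sup>-\<^sup>1 x\<close> on \<open>[0,m+M]\<close>, and the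
  Bhatia--Kittaneh inequality \<open>\<parallel>PQ\<parallel> \<le> \<parallel>P + Q\<parallel>\<^sup>2 / 4\<close> for positive \<open>P, Q\<close> then bounds
  \<open>\<parallel>X\<^sup>s G\<^sup>-\<^sup>s\<parallel>\<close>, which is the claim.

  The recursions converge because both means are convex for a metric (the norm, respectively the
  Thompson metric, by Loewner--Heinz): changing a single argument contracts distances by
  \<open>max t (1-t)\<close>, and consecutive entries of the next iterate are means of lists that differ in
  one place.
\<close>

subsection \<open>Operators and the Loewner order\<close>

unbundle inner_syntax

lemma bounded_linear_pointwise_limit:
  fixes X :: "nat \<Rightarrow> 'b::real_normed_vector \<Rightarrow>\<^sub>L 'c::real_normed_vector"
  assumes bounded: "\<And>n. norm (X n) \<le> K" and pointwise: "\<And>x. (\<lambda>n. X n x) \<longlonglongrightarrow> v x"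
  shows "bounded_linear v"
proof (rule bounded_linear_intro)
  show "v (x + y) = v x + v y" for x y
    using tendsto_add[OF pointwise[of x] pointwise[of y]] pointwise[of "x + y"]
    by (simp add: blinfun.add_right LIMSEQ_unique)
  show "v (r *\<^sub>R x) = r *\<^sub>R v x" for r x
    using tendsto_scaleR[OF tendsto_const[of r] pointwise[of x]] pointwise[of "r *\<^sub>R x"]
    by (simp add: blinfun.scaleR_right LIMSEQ_unique)
  show "norm (v x) \<le> norm x * K" for x
  proof (rule tendsto_upperbound[OF tendsto_norm[OF pointwise]])
    have "norm (X n x) \<le> norm x * K" for n
      using norm_blinfun[of "X n" x] mult_right_mono[OF bounded[of n] norm_ge_zero[of x]]
      by (simp add: mult.commute)
    then show "\<forall>\<^sub>F n in sequentially. norm (X n x) \<le> norm x * K" by simp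
  qed simp
qed

lemma blinfun_pointwise_limit_imp_LIMSEQ:
  fixes X :: "nat \<Rightarrow> 'b::real_normed_vector \<Rightarrow>\<^sub>L 'c::real_normed_vector"
  assumes "Cauchy X" and v_linear: "bounded_linear v" and pointwise: "\<And>x. (\<lambda>n. X n x) \<longlonglongrightarrow> v x"
  shows "X \<longlonglongrightarrow> Blinfun v"
proof (rule LIMSEQ_I)
  fix e :: real assume "e > 0"
  then obtain N where N: "norm (X m - X n) < e / 2" if "m \<ge> N" "n \<ge> N" for m n
    using CauchyD[OF \<open>Cauchy X\<close>, of "e / 2"] by auto
  have "norm (X n - Blinfun v) \<le> e / 2" if n_ge: "n \<ge> N" for n
  proof (rule norm_blinfun_bound)
    fix x
    have "norm (X n x - X m x) \<le> e / 2 * norm x" if "m \<ge> N" for m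
    proof -
      have "norm (X n x - X m x) \<le> norm (X n - X m) * norm x"
        using norm_blinfun[of "X n - X m" x] by (simp add: blinfun.diff_left)
      also have "\<dots> \<le> e / 2 * norm x"
        using N[OF n_ge that] by (intro mult_right_mono) simp_all
      finally show ?thesis .
    qed
    then have "\<forall>\<^sub>F m in sequentially. norm (X n x - X m x) \<le> e / 2 * norm x"
      by (rule eventually_sequentiallyI)
    then have "norm (X n x - v x) \<le> e / 2 * norm x"
      by (rule tendsto_upperbound[OF tendsto_norm[OF tendsto_diff[OF tendsto_const pointwise]]]) simp
    then show "norm ((X n - Blinfun v) x) \<le> e / 2 * norm x"
      by (simp add: blinfun.diff_left bounded_linear_Blinfun_apply[OF v_linear])
  qed (use \<open>e > 0\<close> in simp)
  moreover have "e / 2 < e" using \<open>e > 0\<close> by simp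
  ultimately show "\<exists>N. \<forall>n\<ge>N. norm (X n - Blinfun v) < e" using le_less_trans by blast
qed

text \<open>The library's completeness instance asks for the class \<^class>\<open>banach\<close>, which the sort of
  the Hilbert spaces considered here does not entail.\<close>

lemma blinfun_Cauchy_convergent:
  fixes X :: "nat \<Rightarrow> 'b::real_normed_vector \<Rightarrow>\<^sub>L 'c::{real_normed_vector,complete_space}"
  assumes "Cauchy X"
  shows "convergent X"
proof -
  have "Cauchy (\<lambda>n. X n x)" for x
    by (rule bounded_linear.Cauchy[OF blinfun.bounded_linear_left assms])
  then obtain v where pointwise: "\<And>x. (\<lambda>n. X n x) \<longlonglongrightarrow> v x"
    unfolding Cauchy_convergent_iff convergent_def by metis
  obtain K where "\<And>n. norm (X n) \<le> K"
    using Cauchy_Bseq[OF assms] unfolding Bseq_def by blast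
  from bounded_linear_pointwise_limit[OF this pointwise] have "X \<longlonglongrightarrow> Blinfun v"
    by (rule blinfun_pointwise_limit_imp_LIMSEQ[OF assms _ pointwise])
  then show ?thesis by (rule convergentI)
qed

lemma blinfun_compose_assoc: "(A o\<^sub>L B) o\<^sub>L C = A o\<^sub>L (B o\<^sub>L C)"
  by (rule blinfun_eqI) simp

lemma blinfun_compose_id [simp]: "A o\<^sub>L id_blinfun = A" "id_blinfun o\<^sub>L A = A"
  by (auto intro: blinfun_eqI)

interpretation blinfun_compose: bounded_bilinear "(o\<^sub>L)"
  by (rule bounded_bilinear_blinfun_compose)

lemmas inner_blinfun_simps = blinfun.bilinear_simps inner_simps dot_square_norm

lemma inner_blinfun_le_norm: "T x \<bullet> x \<le> norm T * (norm x)\<^sup>2" for T :: "'a::real_inner \<Rightarrow>\<^sub>L 'a"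
proof -
  have "T x \<bullet> x \<le> norm (T x) * norm x" by (rule norm_cauchy_schwarz)
  also have "\<dots> \<le> (norm T * norm x) * norm x" by (intro mult_right_mono norm_blinfun) simp
  finally show ?thesis by (simp add: power2_eq_square mult.assoc)
qed

lemma self_adjointD: "self_adjoint T \<Longrightarrow> T x \<bullet> y = x \<bullet> T y"
  by (simp add: self_adjoint_def)

lemma self_adjoint_zero [simp]: "self_adjoint 0"
  and self_adjoint_id [simp]: "self_adjoint id_blinfun"
  and self_adjoint_scaleR [simp]: "self_adjoint A \<Longrightarrow> self_adjoint (c *\<^sub>R A)"
  and self_adjoint_add [simp]: "self_adjoint A \<Longrightarrow> self_adjoint B \<Longrightarrow> self_adjoint (A + B)"
  and self_adjoint_diff [simp]: "self_adjoint A \<Longrightarrow> self_adjoint B \<Longrightarrow> self_adjoint (A - B)"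
  by (auto simp: self_adjoint_def blinfun.bilinear_simps inner_simps)

lemma self_adjoint_compose:
  "self_adjoint A \<Longrightarrow> self_adjoint B \<Longrightarrow> A o\<^sub>L B = B o\<^sub>L A \<Longrightarrow> self_adjoint (A o\<^sub>L B)"
  unfolding self_adjoint_def by (metis blinfun_apply_blinfun_compose)

lemma self_adjoint_limit:
  assumes "\<And>n. self_adjoint (X n)" and lim: "X \<longlonglongrightarrow> L"
  shows "self_adjoint L"
  unfolding self_adjoint_def
proof (intro allI)
  fix x y
  have "(\<lambda>n. X n x \<bullet> y) \<longlonglongrightarrow> L x \<bullet> y" "(\<lambda>n. x \<bullet> X n y) \<longlonglongrightarrow> x \<bullet> L y"
    by (intro tendsto_intros lim)+
  then show "L x \<bullet> y = x \<bullet> L y"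
    using LIMSEQ_unique assms(1) by (simp add: self_adjoint_def)
qed

lemma positive_opD: "positive_op A \<Longrightarrow> self_adjoint A" "positive_op A \<Longrightarrow> 0 \<le> A x \<bullet> x"
  by (simp_all add: positive_op_def)

lemma positive_op_square: "self_adjoint S \<Longrightarrow> positive_op (S o\<^sub>L S)"
  by (simp add: positive_op_def self_adjoint_compose self_adjointD[of S "S x" x for x])

lemma loewner_iff:
  "loewner A B \<longleftrightarrow> self_adjoint (B - A) \<and> (\<forall>x. A x \<bullet> x \<le> B x \<bullet> x)"
  by (simp add: loewner_def positive_op_def blinfun.bilinear_simps inner_simps)

lemma loewnerD: "loewner A B \<Longrightarrow> A x \<bullet> x \<le> B x \<bullet> x"
  by (simp add: loewner_iff)

lemma loewnerI:
  "self_adjoint A \<Longrightarrow> self_adjoint B \<Longrightarrow> (\<And>x. A x \<bullet> x \<le> B x \<bullet> x) \<Longrightarrow> loewner A B"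
  by (simp add: loewner_iff)

lemma positive_op_iff_loewner: "positive_op A \<longleftrightarrow> loewner 0 A"
  by (simp add: loewner_def)

lemma loewner_refl [simp]: "loewner A A"
  by (simp add: loewner_iff)

lemma loewner_trans [trans]:
  assumes AB: "loewner A B" and BC: "loewner B C"
  shows "loewner A C"
proof -
  have "self_adjoint ((C - B) + (B - A))"
    using AB BC unfolding loewner_iff by (intro self_adjoint_add) blast+
  then show ?thesis
    using order_trans[OF loewnerD[OF AB] loewnerD[OF BC]] by (simp add: loewner_iff)
qed

lemma loewner_add: "loewner A B \<Longrightarrow> loewner C D \<Longrightarrow> loewner (A + C) (B + D)"
  using self_adjoint_add[of "B - A" "D - C"]
  by (auto simp: loewner_iff blinfun.bilinear_simps inner_simps algebra_simps add_mono)

lemma loewner_scaleR: "loewner A B \<Longrightarrow> 0 \<le> c \<Longrightarrow> loewner (c *\<^sub>R A) (c *\<^sub>R B)"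
  using self_adjoint_scaleR[of "B - A" c]
  by (auto simp: loewner_iff blinfun.bilinear_simps inner_simps algebra_simps mult_left_mono)

lemma loewner_scaleR_mono: "positive_op A \<Longrightarrow> c \<le> d \<Longrightarrow> loewner (c *\<^sub>R A) (d *\<^sub>R A)"
  by (intro loewnerI) (auto simp: positive_op_def blinfun.bilinear_simps mult_right_mono)

lemma loewner_limit:
  assumes X_le_Y: "\<And>n. loewner (X n) (Y n)" and lim: "X \<longlonglongrightarrow> A" "Y \<longlonglongrightarrow> B"
  shows "loewner A B"
proof -
  have "self_adjoint (Y n - X n)" for n using X_le_Y[of n] by (simp add: loewner_iff)
  then have "self_adjoint (B - A)" by (rule self_adjoint_limit[OF _ tendsto_diff[OF lim(2,1)]])
  moreover have "A x \<bullet> x \<le> B x \<bullet> x" for x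
  proof (rule LIMSEQ_le)
    show "(\<lambda>n. X n x \<bullet> x) \<longlonglongrightarrow> A x \<bullet> x" "(\<lambda>n. Y n x \<bullet> x) \<longlonglongrightarrow> B x \<bullet> x"
      by (intro tendsto_intros lim)+
  qed (use loewnerD[OF X_le_Y] in blast)
  ultimately show ?thesis by (simp add: loewner_iff)
qed

definition sandwich :: "'a::{real_inner,complete_space} op \<Rightarrow> 'a op \<Rightarrow> 'a op" where
  "sandwich S A = S o\<^sub>L A o\<^sub>L S"

lemma sandwich_apply [simp]: "sandwich S A x = S (A (S x))"
  by (simp add: sandwich_def)

lemma sandwich_add: "sandwich S (A + B) = sandwich S A + sandwich S B"
  and sandwich_scaleR: "sandwich S (c *\<^sub>R A) = c *\<^sub>R sandwich S A"
  by (simp_all add: sandwich_def blinfun_compose.bilinear_simps)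

lemma self_adjoint_sandwich: "self_adjoint S \<Longrightarrow> self_adjoint A \<Longrightarrow> self_adjoint (sandwich S A)"
  by (simp add: self_adjoint_def)

lemma positive_op_sandwich: "self_adjoint S \<Longrightarrow> positive_op A \<Longrightarrow> positive_op (sandwich S A)"
  by (simp add: positive_op_def self_adjoint_sandwich self_adjointD[of S "A (S x)" x for x])

lemma loewner_sandwich:
  assumes "self_adjoint S" "loewner A B"
  shows "loewner (sandwich S A) (sandwich S B)"
  using positive_op_sandwich[OF assms(1), of "B - A"] assms(2)
  by (simp add: loewner_def sandwich_def blinfun_compose.bilinear_simps)

lemma norm_self_adjoint_le:
  assumes T: "self_adjoint T" and "0 \<le> c" and form: "\<And>x. \<bar>T x \<bullet> x\<bar> \<le> c * (norm x)\<^sup>2"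
  shows "norm T \<le> c"
proof (rule norm_blinfun_bound[OF \<open>0 \<le> c\<close>])
  fix x
  have polarisation: "4 * (T x \<bullet> y) \<le> 2 * c * ((norm x)\<^sup>2 + (norm y)\<^sup>2)" for y
  proof -
    have "4 * (T x \<bullet> y) = T (x + y) \<bullet> (x + y) - T (x - y) \<bullet> (x - y)"
      using self_adjointD[OF T, of y x]
      by (simp add: blinfun.bilinear_simps inner_simps inner_commute)
    also have "\<dots> \<le> c * (norm (x + y))\<^sup>2 + c * (norm (x - y))\<^sup>2"
      using form[of "x + y"] form[of "x - y"] by linarith
    also have "\<dots> = 2 * c * ((norm x)\<^sup>2 + (norm y)\<^sup>2)"
      by (simp add: power2_norm_eq_inner inner_simps inner_commute algebra_simps)
    finally show ?thesis .
  qed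
  show "norm (T x) \<le> c * norm x"
  proof (cases "T x = 0")
    case False
    define y where "y = (norm x / norm (T x)) *\<^sub>R T x"
    have "T x \<bullet> y = norm x * norm (T x)" "norm y = norm x"
      using False by (simp_all add: y_def dot_square_norm power2_eq_square)
    then have "4 * (norm x * norm (T x)) \<le> 4 * c * (norm x)\<^sup>2" using polarisation[of y] by simp
    moreover have "norm x > 0" using False by (auto simp: blinfun.zero_right)
    ultimately show ?thesis by (simp add: power2_eq_square)
  qed (use \<open>0 \<le> c\<close> in simp)
qed

lemma discriminant_le_of_nonneg_quadratic:
  fixes a b c :: real
  assumes nonneg: "\<And>s. 0 \<le> a + 2 * s * c + s\<^sup>2 * b" and "0 \<le> b"
  shows "c\<^sup>2 \<le> a * b"
proof (cases "b = 0")
  case True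
  have "c = 0"
  proof (rule ccontr)
    assume "c \<noteq> 0"
    then have "a + 2 * (- (a + 1) / (2 * c)) * c = - 1" by (simp add: field_simps)
    then show False using nonneg[of "- (a + 1) / (2 * c)"] True by simp
  qed
  then show ?thesis using True by simp
next
  case False
  then have "b > 0" using \<open>0 \<le> b\<close> by simp
  then have "c\<^sup>2 / b \<le> a" using nonneg[of "- c / b"] by (simp add: power2_eq_square)
  then show ?thesis using \<open>b > 0\<close> by (simp add: pos_divide_le_eq)
qed

lemma positive_op_Cauchy_Schwarz:
  assumes "positive_op S"
  shows "(S x \<bullet> y)\<^sup>2 \<le> (S x \<bullet> x) * (S y \<bullet> y)"
proof (rule discriminant_le_of_nonneg_quadratic)
  have symm: "S y \<bullet> x = S x \<bullet> y"
    using self_adjointD[OF positive_opD(1)[OF assms], of y x] by (simp add: inner_commute)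
  fix s
  have "S (x + s *\<^sub>R y) \<bullet> (x + s *\<^sub>R y) = S x \<bullet> x + 2 * s * (S x \<bullet> y) + s\<^sup>2 * (S y \<bullet> y)"
    by (simp add: blinfun.bilinear_simps inner_simps symm power2_eq_square algebra_simps)
  then show "0 \<le> S x \<bullet> x + 2 * s * (S x \<bullet> y) + s\<^sup>2 * (S y \<bullet> y)"
    using positive_opD(2)[OF assms] by metis
qed (rule positive_opD(2)[OF assms])

lemma norm_positive_op_apply:
  assumes S: "positive_op S"
  shows "(norm (S x))\<^sup>2 \<le> norm S * (S x \<bullet> x)"
proof (cases "S x = 0")
  case False
  have "(norm (S x))\<^sup>2 * (norm (S x))\<^sup>2 \<le> (S x \<bullet> x) * (S (S x) \<bullet> S x)"
    using positive_op_Cauchy_Schwarz[OF S, of x "S x"]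
    by (simp add: dot_square_norm power2_eq_square)
  also have "\<dots> \<le> (S x \<bullet> x) * (norm S * (norm (S x))\<^sup>2)"
    by (intro mult_left_mono inner_blinfun_le_norm positive_opD[OF S])
  finally have "(norm (S x))\<^sup>2 * (norm (S x))\<^sup>2 \<le> (norm S * (S x \<bullet> x)) * (norm (S x))\<^sup>2"
    by (simp add: mult.left_commute mult.commute)
  then show ?thesis by (rule mult_right_le_imp_le) (use False in simp)
qed (use positive_opD[OF S] in simp)

lemma positive_op_bounded_below:
  assumes S: "positive_op S" and "0 < e" and below: "\<And>x. e * norm x \<le> norm (S x)"
  obtains \<delta> where "0 < \<delta>" "loewner (\<delta> *\<^sub>R id_blinfun) S"
proof
  let ?\<delta> = "e\<^sup>2 / (norm S + 1)"
  have pos: "norm S + 1 > 0" by (simp add: add_nonneg_pos)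
  show "0 < ?\<delta>" using \<open>0 < e\<close> pos by simp
  show "loewner (?\<delta> *\<^sub>R id_blinfun) S"
  proof (rule loewnerI)
    fix x
    have "e\<^sup>2 * (norm x)\<^sup>2 \<le> (norm (S x))\<^sup>2"
      using power_mono[OF below[of x], of 2] \<open>0 < e\<close> by (simp add: power_mult_distrib)
    also have "\<dots> \<le> norm S * (S x \<bullet> x)" by (rule norm_positive_op_apply[OF S])
    also have "\<dots> \<le> (norm S + 1) * (S x \<bullet> x)" by (simp add: mult_right_mono positive_opD[OF S])
    finally show "(?\<delta> *\<^sub>R id_blinfun) x \<bullet> x \<le> S x \<bullet> x"
      using pos by (simp add: inner_blinfun_simps field_simps)
  qed (use positive_opD[OF S] in simp_all)
qed

subsection \<open>Order intervals of operators\<close>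

definition op_interval :: "real \<Rightarrow> real \<Rightarrow> 'a::{real_inner,complete_space} op set" where
  "op_interval a b = {X. loewner (a *\<^sub>R id_blinfun) X \<and> loewner X (b *\<^sub>R id_blinfun)}"

lemma op_interval_self_adjoint: "X \<in> op_interval a b \<Longrightarrow> self_adjoint X"
  using self_adjoint_add[of "X - a *\<^sub>R id_blinfun" "a *\<^sub>R id_blinfun"]
  by (simp add: op_interval_def loewner_iff)

lemma op_interval_iff:
  "X \<in> op_interval a b \<longleftrightarrow>
    self_adjoint X \<and> (\<forall>x. a * (norm x)\<^sup>2 \<le> X x \<bullet> x \<and> X x \<bullet> x \<le> b * (norm x)\<^sup>2)"
proof (cases "self_adjoint X")
  case True
  then show ?thesis
    by (simp add: op_interval_def loewner_iff inner_blinfun_simps all_conj_distrib)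
next
  case False
  then show ?thesis using op_interval_self_adjoint by blast
qed

lemma op_interval_mono: "X \<in> op_interval a b \<Longrightarrow> a' \<le> a \<Longrightarrow> b \<le> b' \<Longrightarrow> X \<in> op_interval a' b'"
  unfolding op_interval_iff by (meson mult_right_mono order_trans zero_le_power2)

lemma op_interval_Int:
  "X \<in> op_interval a b \<Longrightarrow> X \<in> op_interval a' b' \<Longrightarrow> X \<in> op_interval (max a a') (min b b')"
  by (auto simp: op_interval_iff max_def min_def)

lemma op_interval_scaleR: "X \<in> op_interval a b \<Longrightarrow> 0 \<le> c \<Longrightarrow> c *\<^sub>R X \<in> op_interval (c * a) (c * b)"
  by (auto simp: op_interval_iff blinfun.bilinear_simps mult_left_mono mult.assoc)

lemma op_interval_shift:
  "X \<in> op_interval a b \<Longrightarrow> X + c *\<^sub>R id_blinfun \<in> op_interval (a + c) (b + c)"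
  by (auto simp: op_interval_iff inner_blinfun_simps distrib_right)

lemma op_interval_limit:
  assumes "\<And>n. X n \<in> op_interval a b" "X \<longlonglongrightarrow> L"
  shows "L \<in> op_interval a b"
  using loewner_limit[OF _ tendsto_const assms(2), of "a *\<^sub>R id_blinfun"]
    loewner_limit[OF _ assms(2) tendsto_const, of "b *\<^sub>R id_blinfun"] assms(1)
  by (simp add: op_interval_def)

lemma complete_op_interval: "complete (op_interval a b)"
  unfolding complete_def convergent_def[symmetric]
proof (intro allI impI)
  fix X :: "nat \<Rightarrow> 'a op" assume X: "(\<forall>n. X n \<in> op_interval a b) \<and> Cauchy X"
  then obtain L where "X \<longlonglongrightarrow> L" using blinfun_Cauchy_convergent by (auto simp: convergent_def)
  then show "\<exists>L\<in>op_interval a b. X \<longlonglongrightarrow> L" using X op_interval_limit by blast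
qed

lemma op_interval_singleton:
  assumes "X \<in> op_interval a a"
  shows "X = a *\<^sub>R id_blinfun"
proof -
  have "norm (X - a *\<^sub>R id_blinfun) \<le> 0"
    using assms by (intro norm_self_adjoint_le) (auto simp: op_interval_iff inner_blinfun_simps)
  then show ?thesis by simp
qed

lemma op_interval_empty:
  fixes X :: "'a::{real_inner,complete_space} op" and x :: 'a
  assumes "X \<in> op_interval a b" "b < a"
  shows "x = 0"
proof -
  have "a * (norm x)\<^sup>2 \<le> b * (norm x)\<^sup>2"
    using assms(1) order_trans[of "a * (norm x)\<^sup>2" "X x \<bullet> x" "b * (norm x)\<^sup>2"]
    by (simp add: op_interval_iff)
  then show ?thesis using assms(2) by (auto simp: mult_le_cancel_right)
qed

subsection \<open>Polynomials of a self-adjoint operator\<close>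

lemma op_power_0: "op_power X 0 = id_blinfun"
  by (simp add: op_power_def)

lemma op_power_Suc: "op_power X (Suc k) = X o\<^sub>L op_power X k"
  by (simp add: op_power_def)

lemma polyop_altdef:
  assumes "degree q \<le> N"
  shows "polyop q X = (\<Sum>i\<le>N. coeff q i *\<^sub>R op_power X i)"
  unfolding polyop_def
  by (rule sum.mono_neutral_left) (use assms in \<open>auto simp: coeff_eq_0\<close>)

lemma polyop_0 [simp]: "polyop 0 X = 0"
  by (simp add: polyop_def)

lemma polyop_add: "polyop (p + q) X = polyop p X + polyop q X"
proof -
  let ?N = "max (degree p) (degree q)"
  have "polyop (p + q) X = (\<Sum>i\<le>?N. coeff (p + q) i *\<^sub>R op_power X i)"
    by (intro polyop_altdef degree_add_le_max)
  also have "\<dots> = (\<Sum>i\<le>?N. coeff p i *\<^sub>R op_power X i) + (\<Sum>i\<le>?N. coeff q i *\<^sub>R op_power X i)"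
    by (simp add: scaleR_add_left sum.distrib)
  finally show ?thesis
    using polyop_altdef[of p ?N X] polyop_altdef[of q ?N X] by simp
qed

lemma polyop_sum: "polyop (\<Sum>i\<in>I. q i) X = (\<Sum>i\<in>I. polyop (q i) X)"
  by (induction I rule: infinite_finite_induct) (simp_all add: polyop_add)

lemma polyop_pCons: "polyop (pCons a p) X = a *\<^sub>R id_blinfun + (X o\<^sub>L polyop p X)"
proof -
  have "polyop (pCons a p) X = (\<Sum>i\<le>Suc (degree p). coeff (pCons a p) i *\<^sub>R op_power X i)"
    by (intro polyop_altdef degree_pCons_le)
  also have "\<dots> = a *\<^sub>R id_blinfun + (\<Sum>i\<le>degree p. coeff p i *\<^sub>R (X o\<^sub>L op_power X i))"
    unfolding sum.atMost_Suc_shift by (simp add: op_power_0 op_power_Suc)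
  also have "(\<Sum>i\<le>degree p. coeff p i *\<^sub>R (X o\<^sub>L op_power X i)) = X o\<^sub>L polyop p X"
    unfolding polyop_def blinfun_compose.sum_right
    by (simp add: blinfun_compose.bilinear_simps)
  finally show ?thesis .
qed

lemma polyop_const: "polyop [:c:] X = c *\<^sub>R id_blinfun"
  by (simp add: polyop_pCons)

lemma polyop_linear: "polyop [:c, d:] X = c *\<^sub>R id_blinfun + d *\<^sub>R X"
  by (simp add: polyop_pCons blinfun_compose.bilinear_simps)

lemma polyop_smult: "polyop (smult c q) X = c *\<^sub>R polyop q X"
  using polyop_altdef[OF degree_smult_le, of c q X] by (simp add: polyop_def scaleR_sum_right)

lemma polyop_diff: "polyop (p - q) X = polyop p X - polyop q X"
  using polyop_add[of p "smult (-1) q" X] polyop_smult[of "-1" q X] by simp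

lemma polyop_mult: "polyop (p * q) X = polyop p X o\<^sub>L polyop q X"
  by (induction p)
    (simp_all add: polyop_add polyop_smult polyop_pCons
      blinfun_compose.bilinear_simps blinfun_compose_assoc)

lemma polyop_pcompose: "polyop (pcompose q r) X = polyop q (polyop r X)"
  by (induction q) (simp_all add: pcompose_pCons polyop_add polyop_mult polyop_pCons)

lemma polyop_scaleR_id: "polyop q (c *\<^sub>R id_blinfun) = poly q c *\<^sub>R id_blinfun"
  by (induction q) (simp_all add: polyop_pCons blinfun_compose.bilinear_simps scaleR_add_left)

lemma polyop_intertwine:
  assumes "Z o\<^sub>L X = Y o\<^sub>L Z"
  shows "Z o\<^sub>L polyop q X = polyop q Y o\<^sub>L Z"
proof (induction q)
  case (pCons a q)
  have "Z o\<^sub>L (X o\<^sub>L polyop q X) = Y o\<^sub>L (Z o\<^sub>L polyop q X)"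
    using assms by (metis blinfun_compose_assoc)
  then show ?case
    using pCons by (simp add: polyop_pCons blinfun_compose.bilinear_simps blinfun_compose_assoc)
qed simp

lemma self_adjoint_polyop:
  assumes "self_adjoint X"
  shows "self_adjoint (polyop q X)"
proof (induction q)
  case (pCons a q)
  have "X o\<^sub>L polyop q X = polyop q X o\<^sub>L X" by (rule polyop_intertwine) simp
  then have "self_adjoint (X o\<^sub>L polyop q X)" using assms pCons by (intro self_adjoint_compose) auto
  then show ?case by (simp add: polyop_pCons)
qed simp

lemma continuous_on_polyop: "continuous_on S (polyop q)"
proof (induction q)
  case (pCons a q)
  then show ?case
    unfolding polyop_pCons
    by (intro continuous_intros blinfun_compose.continuous_on)
qed simp

subsection \<open>Positivity of the polynomial calculus\<close>

text \<open>A polynomial that is positive on \<open>[0,1]\<close> has non-negative Bernstein coefficients of high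
  order, and the Bernstein polynomials of an operator in \<open>[0,1]\<close> are positive.\<close>

definition bernstein_poly :: "nat \<Rightarrow> nat \<Rightarrow> real poly" where
  "bernstein_poly n k = smult (of_nat (n choose k)) ([:0, 1:] ^ k * [:1, -1:] ^ (n - k))"

definition bernstein_coeff :: "nat \<Rightarrow> real poly \<Rightarrow> nat \<Rightarrow> real" where
  "bernstein_coeff n q k = (\<Sum>j\<le>degree q. coeff q j * (of_nat (k choose j) / of_nat (n choose j)))"

lemma poly_bernstein_poly: "poly (bernstein_poly n k) x = Bernstein n k x"
  by (simp add: bernstein_poly_def Bernstein_def)

lemma power_eq_sum_Bernstein:
  assumes "j \<le> n"
  shows "x ^ j = (\<Sum>k\<le>n. of_nat (k choose j) / of_nat (n choose j) * Bernstein n k x)"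
proof -
  have "x ^ j = x ^ j * (x + (1 - x)) ^ (n - j)" by simp
  also have "\<dots> = (\<Sum>i\<le>n - j. of_nat (n - j choose i) * x ^ (i + j) * (1 - x) ^ (n - j - i))"
    unfolding binomial_ring by (simp add: sum_distrib_left power_add mult_ac)
  also have "\<dots> = (\<Sum>k\<in>{j..n}. of_nat (n - j choose (k - j)) * x ^ k * (1 - x) ^ (n - k))"
    by (rule sum.reindex_bij_witness[of _ "\<lambda>k. k - j" "\<lambda>i. i + j"])
      (use assms in \<open>auto simp: add.commute\<close>)
  also have "\<dots> = (\<Sum>k\<in>{j..n}. of_nat (k choose j) / of_nat (n choose j) * Bernstein n k x)"
  proof (rule sum.cong[OF refl])
    fix k assume "k \<in> {j..n}"
    then have "real (n choose k) * real (k choose j)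
        = real (n choose j) * real (n - j choose (k - j))"
      using choose_mult[of j k n] by (metis atLeastAtMost_iff of_nat_mult)
    then show "of_nat (n - j choose (k - j)) * x ^ k * (1 - x) ^ (n - k)
        = of_nat (k choose j) / of_nat (n choose j) * Bernstein n k x"
      using assms by (simp add: Bernstein_def field_simps)
  qed
  also have "\<dots> = (\<Sum>k\<le>n. of_nat (k choose j) / of_nat (n choose j) * Bernstein n k x)"
    by (rule sum.mono_neutral_left) auto
  finally show ?thesis .
qed

lemma bernstein_expansion:
  assumes "degree q \<le> n"
  shows "q = (\<Sum>k\<le>n. smult (bernstein_coeff n q k) (bernstein_poly n k))"
proof (rule poly_ext)
  fix x
  have "poly q x = (\<Sum>j\<le>degree q. coeff q j *
      (\<Sum>k\<le>n. of_nat (k choose j) / of_nat (n choose j) * Bernstein n k x))"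
    unfolding poly_altdef using assms
    by (intro sum.cong refl) (simp add: power_eq_sum_Bernstein[of _ n x])
  also have "\<dots> = (\<Sum>k\<le>n. bernstein_coeff n q k * Bernstein n k x)"
    unfolding bernstein_coeff_def sum_distrib_left sum_distrib_right
    by (subst sum.swap) (simp add: mult_ac)
  finally show "poly q x = poly (\<Sum>k\<le>n. smult (bernstein_coeff n q k) (bernstein_poly n k)) x"
    by (simp add: poly_sum poly_bernstein_poly)
qed

lemma choose_ratio_approx:
  assumes "j \<le> n" "k \<le> n"
  shows "\<bar>real (k choose j) / real (n choose j) - (real k / real n) ^ j\<bar> \<le> (real j)\<^sup>2 / real n"
proof -
  define r where "r i = real (k - i) / real (n - i)" for i
  have ratio: "real (k choose j) / real (n choose j) = (\<Prod>i<j. r i)"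
  proof (cases "j \<le> k")
    case True
    then show ?thesis
      using assms by (simp add: binomial_altdef_of_nat prod_dividef r_def atLeast0LessThan)
  next
    case False
    then have "(\<Prod>i<j. r i) = 0" by (intro prod_zero bexI[of _ k]) (auto simp: r_def)
    then show ?thesis using False by (simp add: binomial_eq_0 del: prod_zero_iff)
  qed
  have factor: "\<bar>r i - real k / real n\<bar> \<le> real j / real n" if "i < j" for i
  proof (cases "i \<le> k")
    case True
    have "real k / real n - r i = real i * (real n - real k) / (real n * (real n - real i))"
      using True that assms by (simp add: r_def of_nat_diff field_simps)
    also have "\<dots> = (real i / real n) * ((real n - real k) / (real n - real i))" by simp
    finally have "real k / real n - r i
        = (real i / real n) * ((real n - real k) / (real n - real i))" .
    moreover have "0 \<le> (real i / real n) * ((real n - real k) / (real n - real i))"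
      using that assms by simp
    moreover have "(real i / real n) * ((real n - real k) / (real n - real i))
        \<le> (real j / real n) * 1"
      using that assms True by (intro mult_mono) (auto simp: divide_right_mono)
    ultimately show ?thesis by simp
  next
    case False
    then show ?thesis using that assms by (simp add: r_def divide_right_mono)
  qed
  have "\<bar>(\<Prod>i<j. r i) - (\<Prod>i<j. real k / real n)\<bar> \<le> (\<Sum>i<j. \<bar>r i - real k / real n\<bar>)"
    unfolding real_norm_def[symmetric]
    by (rule norm_prod_diff) (use assms in \<open>auto simp: r_def divide_le_eq_1\<close>)
  also have "\<dots> \<le> (\<Sum>i<j. real j / real n)" by (intro sum_mono factor) simp
  finally show ?thesis by (simp add: ratio power2_eq_square)
qed

lemma bernstein_coeff_nonneg:
  assumes "0 < e" and above: "\<And>x. x \<in> {0..1} \<Longrightarrow> e \<le> poly q x"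
  obtains n where "degree q \<le> n" "\<And>k. k \<le> n \<Longrightarrow> 0 \<le> bernstein_coeff n q k"
proof -
  define C where "C = (\<Sum>j\<le>degree q. \<bar>coeff q j\<bar> * (real j)\<^sup>2)"
  obtain N where N: "C / e < real N" using reals_Archimedean2 by blast
  define n where "n = N + degree q + 1"
  have "C / real n \<le> e"
  proof -
    have "C \<le> e * real N" using N \<open>0 < e\<close> by (simp add: field_simps)
    also have "\<dots> \<le> e * real n" using \<open>0 < e\<close> by (simp add: n_def)
    finally show ?thesis by (simp add: n_def field_simps)
  qed
  have "0 \<le> bernstein_coeff n q k" if "k \<le> n" for k
  proof -
    let ?x = "real k / real n"
    have "bernstein_coeff n q k - poly q ?x
        = (\<Sum>j\<le>degree q. coeff q j * (real (k choose j) / real (n choose j) - ?x ^ j))"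
      unfolding bernstein_coeff_def poly_altdef
      by (simp add: sum_subtractf[symmetric] right_diff_distrib)
    also have "\<bar>\<dots>\<bar> \<le> (\<Sum>j\<le>degree q. \<bar>coeff q j\<bar> * ((real j)\<^sup>2 / real n))"
    proof (rule order_trans[OF sum_abs sum_mono])
      fix j assume "j \<in> {..degree q}"
      then have "j \<le> n" by (simp add: n_def)
      from mult_left_mono[OF choose_ratio_approx[OF this \<open>k \<le> n\<close>], of "\<bar>coeff q j\<bar>"]
      show "\<bar>coeff q j * (real (k choose j) / real (n choose j) - ?x ^ j)\<bar>
          \<le> \<bar>coeff q j\<bar> * ((real j)\<^sup>2 / real n)"
        by (simp add: abs_mult)
    qed
    also have "\<dots> = C / real n" by (simp add: C_def sum_divide_distrib)
    finally have "\<bar>bernstein_coeff n q k - poly q ?x\<bar> \<le> C / real n" .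
    moreover have "e \<le> poly q ?x" using that by (intro above) (auto simp: n_def divide_le_eq_1)
    ultimately show ?thesis using \<open>C / real n \<le> e\<close> by linarith
  qed
  then show thesis using that[of n] by (simp add: n_def)
qed

lemma positive_op_polyop_square_mult:
  assumes "self_adjoint X" "positive_op (polyop p X)"
  shows "positive_op (polyop (s\<^sup>2 * p) X)"
proof -
  have "s\<^sup>2 * p = s * p * s" by (simp add: power2_eq_square mult_ac)
  then have "polyop (s\<^sup>2 * p) X = sandwich (polyop s X) (polyop p X)"
    by (simp only: polyop_mult sandwich_def)
  then show ?thesis using assms by (simp only: positive_op_sandwich self_adjoint_polyop)
qed

lemma positive_op_add: "positive_op A \<Longrightarrow> positive_op B \<Longrightarrow> positive_op (A + B)"
  using loewner_add[of 0 A 0 B] by (simp add: positive_op_iff_loewner)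

lemma positive_op_scaleR: "positive_op A \<Longrightarrow> 0 \<le> c \<Longrightarrow> positive_op (c *\<^sub>R A)"
  using loewner_scaleR[of 0 A c] by (simp add: positive_op_iff_loewner)

lemma positive_op_sum: "(\<And>i. i \<in> I \<Longrightarrow> positive_op (A i)) \<Longrightarrow> positive_op (\<Sum>i\<in>I. A i)"
  by (induction I rule: infinite_finite_induct)
    (simp_all add: positive_op_add positive_op_iff_loewner[of 0])

lemma positive_op_bernstein_poly:
  assumes X: "X \<in> op_interval 0 1"
  shows "positive_op (polyop (bernstein_poly n k) X)"
proof -
  let ?x = "[:0, 1:] :: real poly" and ?y = "[:1, -1:] :: real poly"
  have X_sa: "self_adjoint X" using X by (rule op_interval_self_adjoint)
  have linear_factors: "positive_op (polyop 1 X)" "positive_op (polyop ?x X)"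
    "positive_op (polyop ?y X)"
    using X by (simp_all add: one_pCons polyop_linear polyop_const op_interval_def loewner_def
        positive_op_def inner_blinfun_simps)
  have "?x * ?y = ?x\<^sup>2 * ?y + ?y\<^sup>2 * ?x" by (simp add: power2_eq_square)
  then have "positive_op (polyop (?x * ?y) X)"
    using linear_factors
    by (simp only: polyop_add positive_op_add positive_op_polyop_square_mult[OF X_sa])
  with linear_factors have "positive_op (polyop (?x ^ (k mod 2) * ?y ^ (l mod 2)) X)" for l
    by (cases "even k"; cases "even l") (simp_all add: even_iff_mod_2_eq_zero odd_iff_mod_2_eq_one)
  then have "positive_op (polyop ((?x ^ (k div 2) * ?y ^ (l div 2))\<^sup>2
      * (?x ^ (k mod 2) * ?y ^ (l mod 2))) X)"
    for l
    by (intro positive_op_polyop_square_mult X_sa)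
  moreover have "(?x ^ (k div 2) * ?y ^ (l div 2))\<^sup>2 * (?x ^ (k mod 2) * ?y ^ (l mod 2))
      = ?x ^ k * ?y ^ l" for l
    by (simp add: power_mult_distrib power_mult[symmetric] mult_ac power_add[symmetric])
  ultimately show ?thesis
    by (simp add: bernstein_poly_def polyop_smult positive_op_scaleR)
qed

lemma positive_op_polyop_unit_interval:
  assumes X: "X \<in> op_interval 0 1" and nonneg: "\<And>x. x \<in> {0..1} \<Longrightarrow> 0 \<le> poly q x"
  shows "positive_op (polyop q X)"
  unfolding positive_op_def
proof (intro conjI allI)
  show "self_adjoint (polyop q X)" by (intro self_adjoint_polyop op_interval_self_adjoint[OF X])
  fix x
  have nonneg_eps: "0 \<le> polyop q X x \<bullet> x + e * (norm x)\<^sup>2" if "0 < e" for e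
  proof -
    define r where "r = q + [:e:]"
    obtain n where expansion: "degree r \<le> n" "\<And>k. k \<le> n \<Longrightarrow> 0 \<le> bernstein_coeff n r k"
      using bernstein_coeff_nonneg[OF \<open>0 < e\<close>, of r] nonneg by (auto simp: r_def)
    have "polyop r X = (\<Sum>k\<le>n. bernstein_coeff n r k *\<^sub>R polyop (bernstein_poly n k) X)"
      by (subst bernstein_expansion[OF expansion(1)]) (simp add: polyop_sum polyop_smult)
    then have "positive_op (polyop r X)"
      using expansion(2)
      by (auto intro!: positive_op_sum positive_op_scaleR positive_op_bernstein_poly[OF X])
    from positive_opD(2)[OF this, of x] show ?thesis
      by (simp add: r_def polyop_add polyop_const inner_blinfun_simps)
  qed
  show "0 \<le> polyop q X x \<bullet> x"
  proof (cases "x = 0")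
    case False
    then have "0 \<le> polyop q X x \<bullet> x + e" if "0 < e" for e
      using nonneg_eps[of "e / (norm x)\<^sup>2"] that by simp
    then show ?thesis by (rule field_le_epsilon)
  qed simp
qed

lemma positive_op_polyop:
  fixes X :: "'a::{real_inner,complete_space} op"
  assumes X: "X \<in> op_interval a b" and nonneg: "\<And>x. x \<in> {a..b} \<Longrightarrow> 0 \<le> poly q x"
  shows "positive_op (polyop q X)"
proof -
  consider "a < b" | "a = b" | "b < a" by linarith
  then show ?thesis
  proof cases
    case 1
    define Y where "Y = (1 / (b - a)) *\<^sub>R (X + (- a) *\<^sub>R id_blinfun)"
    have Y: "Y \<in> op_interval 0 1"
      using op_interval_scaleR[OF op_interval_shift[OF X, of "- a"], of "1 / (b - a)"] 1
      by (simp add: Y_def)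
    have "polyop [:a, b - a:] Y = X" using 1 by (simp add: polyop_linear Y_def)
    then have "polyop q X = polyop (pcompose q [:a, b - a:]) Y" by (simp add: polyop_pcompose)
    moreover have "0 \<le> poly (pcompose q [:a, b - a:]) x" if "x \<in> {0..1}" for x
    proof -
      have "a + x * (b - a) = b - (1 - x) * (b - a)" by (simp add: algebra_simps)
      also have "\<dots> \<le> b" using that 1 by simp
      finally have "a + x * (b - a) \<le> b" .
      moreover have "a \<le> a + x * (b - a)" using that 1 by simp
      ultimately show ?thesis by (simp add: poly_pcompose nonneg)
    qed
    ultimately show ?thesis using positive_op_polyop_unit_interval[OF Y] by simp
  next
    case 2
    then have "polyop q X = poly q a *\<^sub>R id_blinfun"
      using op_interval_singleton[of X a] X by (simp add: polyop_scaleR_id)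
    then show ?thesis using nonneg[of a] 2 by (simp add: positive_op_def inner_blinfun_simps)
  next
    case 3
    then have "x = 0" for x :: 'a using op_interval_empty[OF X] by blast
    then show ?thesis
      unfolding positive_op_def self_adjoint_def
      by (metis inner_zero_left inner_zero_right order_refl)
  qed
qed

lemma norm_polyop_le:
  assumes X: "X \<in> op_interval a b" and "0 \<le> c" and bound: "\<And>x. x \<in> {a..b} \<Longrightarrow> \<bar>poly q x\<bar> \<le> c"
  shows "norm (polyop q X) \<le> c"
proof (rule norm_self_adjoint_le[OF _ \<open>0 \<le> c\<close>])
  show "self_adjoint (polyop q X)"
    by (intro self_adjoint_polyop op_interval_self_adjoint[OF X])
  fix x
  have "positive_op (polyop ([:c:] - q) X)" "positive_op (polyop ([:c:] + q) X)"
    using bound by (intro positive_op_polyop[OF X]; force simp: abs_le_iff)+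
  then show "\<bar>polyop q X x \<bullet> x\<bar> \<le> c * (norm x)\<^sup>2"
    using positive_opD(2)[of "polyop ([:c:] - q) X" x] positive_opD(2)[of "polyop ([:c:] + q) X" x]
    by (simp add: polyop_diff polyop_add polyop_const inner_blinfun_simps)
qed

subsection \<open>The continuous functional calculus\<close>

lemma polyop_eventually_close:
  assumes X: "X \<in> op_interval a b" "X \<in> op_interval a' b'"
    and p_lim: "uniform_limit {a..b} (\<lambda>k x. poly (p k) x) f sequentially"
    and q_lim: "uniform_limit {a'..b'} (\<lambda>k x. poly (q k) x) f sequentially" and "0 < e"
  obtains N where "\<And>j k. j \<ge> N \<Longrightarrow> k \<ge> N \<Longrightarrow> norm (polyop (p j) X - polyop (q k) X) < e"
proof -
  have "0 < e / 4" using \<open>0 < e\<close> by simp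
  obtain Np where Np: "\<bar>poly (p j) x - f x\<bar> < e / 4" if "j \<ge> Np" "x \<in> {a..b}" for j x
    using p_lim \<open>0 < e / 4\<close> unfolding uniform_limit_sequentially_iff dist_real_def by blast
  obtain Nq where Nq: "\<bar>poly (q k) x - f x\<bar> < e / 4" if "k \<ge> Nq" "x \<in> {a'..b'}" for k x
    using q_lim \<open>0 < e / 4\<close> unfolding uniform_limit_sequentially_iff dist_real_def by blast
  have "norm (polyop (p j) X - polyop (q k) X) < e" if "j \<ge> max Np Nq" "k \<ge> max Np Nq" for j k
  proof -
    have "norm (polyop (p j - q k) X) \<le> e / 2"
    proof (rule norm_polyop_le[OF op_interval_Int[OF X]])
      fix x assume "x \<in> {max a a'..min b b'}"
      then show "\<bar>poly (p j - q k) x\<bar> \<le> e / 2"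
        using Np[of j x] Nq[of k x] that by (simp add: abs_if split: if_splits)
    qed (use \<open>0 < e\<close> in simp)
    then show ?thesis using \<open>0 < e\<close> by (simp add: polyop_diff)
  qed
  then show thesis by (rule that)
qed

lemma tendsto_cfun:
  assumes X: "X \<in> op_interval a b"
    and q_lim: "uniform_limit {a..b} (\<lambda>k x. poly (q k) x) f sequentially"
  shows "(\<lambda>k. polyop (q k) X) \<longlonglongrightarrow> cfun f X"
proof -
  have "Cauchy (\<lambda>k. polyop (q k) X)"
    by (rule CauchyI) (metis polyop_eventually_close[OF X X q_lim q_lim])
  then obtain Y where Y: "(\<lambda>k. polyop (q k) X) \<longlonglongrightarrow> Y"
    using blinfun_Cauchy_convergent by (auto simp: convergent_def)
  have limit_unique: "(\<lambda>k. polyop (q' k) X) \<longlonglongrightarrow> Y"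
    if X': "X \<in> op_interval a' b'"
      and q': "uniform_limit {a'..b'} (\<lambda>k x. poly (q' k) x) f sequentially" for a' b' q'
  proof -
    have "(\<lambda>k. polyop (q' k) X - polyop (q k) X) \<longlonglongrightarrow> 0"
      by (rule LIMSEQ_I) (simp, metis polyop_eventually_close[OF X' X q' q_lim])
    from tendsto_add[OF this Y] show ?thesis by simp
  qed
  have "cfun f X = Y"
    unfolding cfun_def
  proof (rule the_equality)
    show "\<forall>a b q. loewner (a *\<^sub>R id_blinfun) X \<and> loewner X (b *\<^sub>R id_blinfun) \<and>
        uniform_limit {a..b} (\<lambda>k x. poly (q k) x) f sequentially
        \<longrightarrow> (\<lambda>k. polyop (q k) X) \<longlonglongrightarrow> Y"
      using limit_unique unfolding op_interval_def by blast
    fix Z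
    assume "\<forall>a b q. loewner (a *\<^sub>R id_blinfun) X \<and> loewner X (b *\<^sub>R id_blinfun) \<and>
        uniform_limit {a..b} (\<lambda>k x. poly (q k) x) f sequentially
        \<longrightarrow> (\<lambda>k. polyop (q k) X) \<longlonglongrightarrow> Z"
    then have "(\<lambda>k. polyop (q k) X) \<longlonglongrightarrow> Z"
      using X q_lim unfolding op_interval_def by blast
    then show "Z = Y" using Y LIMSEQ_unique by blast
  qed
  then show ?thesis using Y by simp
qed

lemma polynomial_approximation:
  fixes f :: "real \<Rightarrow> real"
  assumes "continuous_on {a..b} f"
  obtains q where "uniform_limit {a..b} (\<lambda>k x. poly (q k) x) f sequentially"
proof -
  obtain g where lim: "uniform_limit {a..b} g f sequentially" and "\<And>n. polynomial_function (g n)"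
    using Stone_Weierstrass_uniform_limit[OF compact_Icc assms] by blast
  then have "real_polynomial_function (g n)" for n by (simp add: real_polynomial_function_eq)
  then have "\<exists>q. \<forall>x. g n x = poly q x" for n
  proof -
    obtain c N where "g n = (\<lambda>x. \<Sum>i\<le>N. c i * x ^ i)"
      using \<open>real_polynomial_function (g n)\<close> unfolding real_polynomial_function_iff_sum by blast
    then show ?thesis
      by (intro exI[of _ "\<Sum>i\<le>N. monom (c i) i"]) (simp add: poly_sum poly_monom)
  qed
  then obtain q where "\<And>n x. g n x = poly (q n) x" by metis
  then have "g = (\<lambda>k x. poly (q k) x)" by blast
  then show thesis using lim that by blast
qed

lemma self_adjoint_cfun:
  assumes X: "X \<in> op_interval a b" and "continuous_on {a..b} f"
  shows "self_adjoint (cfun f X)"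
proof -
  obtain q where "uniform_limit {a..b} (\<lambda>k x. poly (q k) x) f sequentially"
    using polynomial_approximation[OF assms(2)] .
  from self_adjoint_limit[OF _ tendsto_cfun[OF X this]] show ?thesis
    using self_adjoint_polyop[OF op_interval_self_adjoint[OF X]] .
qed

lemma cfun_cong:
  assumes X: "X \<in> op_interval a b" and f_cont: "continuous_on {a..b} f"
    and f_eq_g: "\<And>x. x \<in> {a..b} \<Longrightarrow> f x = g x"
  shows "cfun f X = cfun g X"
proof -
  obtain q where q_lim: "uniform_limit {a..b} (\<lambda>k x. poly (q k) x) f sequentially"
    using polynomial_approximation[OF f_cont] .
  then have "uniform_limit {a..b} (\<lambda>k x. poly (q k) x) g sequentially"
    using f_eq_g by (simp add: uniform_limit_sequentially_iff)
  then show ?thesis using tendsto_cfun[OF X] q_lim LIMSEQ_unique by blast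
qed

lemma cfun_poly:
  assumes "X \<in> op_interval a b"
  shows "cfun (\<lambda>x. poly q x) X = polyop q X"
  using tendsto_cfun[OF assms uniform_limit_const] by (simp add: LIMSEQ_const_iff)

lemma cfun_const: "X \<in> op_interval a b \<Longrightarrow> cfun (\<lambda>x. c) X = c *\<^sub>R id_blinfun"
  using cfun_poly[of X a b "[:c:]"] by (simp add: polyop_const)

lemma cfun_ident: "X \<in> op_interval a b \<Longrightarrow> cfun (\<lambda>x. x) X = X"
  using cfun_poly[of X a b "[:0, 1:]"] by (simp add: polyop_linear)

lemma cfun_add:
  assumes X: "X \<in> op_interval a b" and "continuous_on {a..b} f" "continuous_on {a..b} g"
  shows "cfun (\<lambda>x. f x + g x) X = cfun f X + cfun g X"
proof -
  obtain p where p_lim: "uniform_limit {a..b} (\<lambda>k x. poly (p k) x) f sequentially"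
    using polynomial_approximation[OF assms(2)] .
  obtain q where q_lim: "uniform_limit {a..b} (\<lambda>k x. poly (q k) x) g sequentially"
    using polynomial_approximation[OF assms(3)] .
  have "uniform_limit {a..b} (\<lambda>k x. poly (p k + q k) x) (\<lambda>x. f x + g x) sequentially"
    using uniform_limit_add[OF p_lim q_lim] by simp
  from tendsto_cfun[OF X this] tendsto_add[OF tendsto_cfun[OF X p_lim] tendsto_cfun[OF X q_lim]]
  show ?thesis by (simp add: polyop_add LIMSEQ_unique)
qed

lemma cfun_mult:
  assumes X: "X \<in> op_interval a b" and f_cont: "continuous_on {a..b} f"
    and g_cont: "continuous_on {a..b} g"
  shows "cfun (\<lambda>x. f x * g x) X = cfun f X o\<^sub>L cfun g X"
proof -
  obtain p where p_lim: "uniform_limit {a..b} (\<lambda>k x. poly (p k) x) f sequentially"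
    using polynomial_approximation[OF f_cont] .
  obtain q where q_lim: "uniform_limit {a..b} (\<lambda>k x. poly (q k) x) g sequentially"
    using polynomial_approximation[OF g_cont] .
  have "bounded (f ` {a..b})" "bounded (g ` {a..b})"
    by (intro compact_imp_bounded compact_continuous_image f_cont g_cont compact_Icc)+
  then have "uniform_limit {a..b} (\<lambda>k x. poly (p k * q k) x) (\<lambda>x. f x * g x) sequentially"
    using uniform_lim_mult[OF p_lim q_lim] by simp
  from tendsto_cfun[OF X this]
    blinfun_compose.tendsto[OF tendsto_cfun[OF X p_lim] tendsto_cfun[OF X q_lim]]
  show ?thesis by (simp add: polyop_mult LIMSEQ_unique)
qed

lemma cfun_mult_left:
  "X \<in> op_interval a b \<Longrightarrow> continuous_on {a..b} f \<Longrightarrow> cfun (\<lambda>x. c * f x) X = c *\<^sub>R cfun f X"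
  by (simp add: cfun_mult[of X a b] cfun_const[of X a b] blinfun_compose.bilinear_simps)

lemma cfun_diff:
  assumes X: "X \<in> op_interval a b" and f_cont: "continuous_on {a..b} f"
    and g_cont: "continuous_on {a..b} g"
  shows "cfun (\<lambda>x. f x - g x) X = cfun f X - cfun g X"
  using cfun_add[OF X f_cont continuous_on_mult_left[OF g_cont], of "-1"]
    cfun_mult_left[OF X g_cont, of "-1"]
  by simp

lemma cfun_intertwine:
  assumes X: "X \<in> op_interval a b" and Y: "Y \<in> op_interval a b" and f_cont: "continuous_on {a..b} f"
    and Z: "Z o\<^sub>L X = Y o\<^sub>L Z"
  shows "Z o\<^sub>L cfun f X = cfun f Y o\<^sub>L Z"
proof -
  obtain q where q_lim: "uniform_limit {a..b} (\<lambda>k x. poly (q k) x) f sequentially"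
    using polynomial_approximation[OF f_cont] .
  have "(\<lambda>k. Z o\<^sub>L polyop (q k) X) \<longlonglongrightarrow> (Z o\<^sub>L cfun f X)"
    "(\<lambda>k. polyop (q k) Y o\<^sub>L Z) \<longlonglongrightarrow> (cfun f Y o\<^sub>L Z)"
    by (intro blinfun_compose.tendsto tendsto_const tendsto_cfun[OF X q_lim]
        tendsto_cfun[OF Y q_lim])+
  then show ?thesis using polyop_intertwine[OF Z] LIMSEQ_unique by simp
qed

lemma positive_op_cfun:
  assumes X: "X \<in> op_interval a b" and f_cont: "continuous_on {a..b} f"
    and nonneg: "\<And>x. x \<in> {a..b} \<Longrightarrow> 0 \<le> f x"
  shows "positive_op (cfun f X)"
proof -
  have root: "continuous_on {a..b} (\<lambda>x. sqrt (f x))" by (intro continuous_intros f_cont)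
  have "cfun f X = cfun (\<lambda>x. sqrt (f x) * sqrt (f x)) X"
    using nonneg by (intro cfun_cong[OF X f_cont]) simp
  also have "\<dots> = cfun (\<lambda>x. sqrt (f x)) X o\<^sub>L cfun (\<lambda>x. sqrt (f x)) X"
    by (rule cfun_mult[OF X root root])
  finally show ?thesis using positive_op_square[OF self_adjoint_cfun[OF X root]] by simp
qed

lemma cfun_mono:
  assumes X: "X \<in> op_interval a b" and f_cont: "continuous_on {a..b} f"
    and g_cont: "continuous_on {a..b} g"
    and f_le_g: "\<And>x. x \<in> {a..b} \<Longrightarrow> f x \<le> g x"
  shows "loewner (cfun f X) (cfun g X)"
  using positive_op_cfun[OF X continuous_on_diff[OF g_cont f_cont]] f_le_g
  by (simp add: loewner_def cfun_diff[OF X g_cont f_cont])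

lemma cfun_in_op_interval:
  assumes X: "X \<in> op_interval a b" and f_cont: "continuous_on {a..b} f"
    and "\<And>x. x \<in> {a..b} \<Longrightarrow> f x \<in> {c..d}"
  shows "cfun f X \<in> op_interval c d"
  using cfun_mono[OF X continuous_on_const f_cont, of c]
    cfun_mono[OF X f_cont continuous_on_const, of d] assms(3)
  by (simp add: op_interval_def cfun_const[OF X])

lemma norm_cfun_le:
  assumes X: "X \<in> op_interval a b" and f_cont: "continuous_on {a..b} f" and "0 \<le> c"
    and bound: "\<And>x. x \<in> {a..b} \<Longrightarrow> \<bar>f x\<bar> \<le> c"
  shows "norm (cfun f X) \<le> c"
proof -
  have "f x \<in> {- c..c}" if "x \<in> {a..b}" for x using bound[OF that] by (simp add: abs_le_iff)
  then have "cfun f X \<in> op_interval (- c) c" by (rule cfun_in_op_interval[OF X f_cont])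
  then show ?thesis
    using \<open>0 \<le> c\<close>
    by (intro norm_self_adjoint_le) (auto simp: op_interval_iff abs_le_iff minus_le_iff)
qed

lemma tendsto_cfun_uniform:
  assumes X: "X \<in> op_interval a b" and F_cont: "\<And>n. continuous_on {a..b} (F n)"
    and f_cont: "continuous_on {a..b} f"
    and lim: "uniform_limit {a..b} F f G"
  shows "((\<lambda>n. cfun (F n) X) \<longlongrightarrow> cfun f X) G"
proof (rule tendstoI)
  fix e :: real assume "0 < e"
  then have "\<forall>\<^sub>F n in G. \<forall>x\<in>{a..b}. dist (F n x) (f x) < e / 2"
    by (intro uniform_limitD[OF lim]) simp
  then show "\<forall>\<^sub>F n in G. dist (cfun (F n) X) (cfun f X) < e"
  proof eventually_elim
    case (elim n)
    then have "norm (cfun (\<lambda>x. F n x - f x) X) \<le> e / 2"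
      using \<open>0 < e\<close>
      by (intro norm_cfun_le[OF X] continuous_on_diff F_cont f_cont) (force simp: dist_real_def)+
    then show ?case using \<open>0 < e\<close> by (simp add: dist_norm cfun_diff[OF X F_cont f_cont])
  qed
qed

lemma continuous_on_cfun:
  assumes f_cont: "continuous_on {a..b} f"
  shows "continuous_on (op_interval a b :: 'a::{real_inner,complete_space} op set) (cfun f)"
proof -
  obtain q where q_lim: "uniform_limit {a..b} (\<lambda>k x. poly (q k) x) f sequentially"
    using polynomial_approximation[OF f_cont] .
  have "uniform_limit (op_interval a b :: 'a op set) (\<lambda>k X. polyop (q k) X) (cfun f) sequentially"
  proof (rule uniform_limitI)
    fix e :: real assume "0 < e"
    then have "\<forall>\<^sub>F k in sequentially. \<forall>x\<in>{a..b}. dist (poly (q k) x) (f x) < e / 2"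
      by (intro uniform_limitD[OF q_lim]) simp
    then show "\<forall>\<^sub>F k in sequentially. \<forall>X\<in>op_interval a b :: 'a op set.
        dist (polyop (q k) X) (cfun f X) < e"
    proof eventually_elim
      case (elim k)
      note poly = continuous_on_poly[OF continuous_on_id]
      show ?case
      proof
        fix X :: "'a op" assume X: "X \<in> op_interval a b"
        have "norm (cfun (\<lambda>x. poly (q k) x - f x) X) \<le> e / 2"
          using elim \<open>0 < e\<close>
          by (intro norm_cfun_le[OF X] continuous_on_diff f_cont poly) (force simp: dist_real_def)+
        then show "dist (polyop (q k) X) (cfun f X) < e"
          using \<open>0 < e\<close> by (simp add: dist_norm cfun_diff[OF X poly f_cont] cfun_poly[OF X])
      qed
    qed
  qed
  then show ?thesis
    by (rule uniform_limit_theorem[rotated]) (simp_all add: continuous_on_polyop)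
qed

lemma cfun_poly_compose:
  assumes X: "X \<in> op_interval a b" and g_cont: "continuous_on {a..b} g"
  shows "cfun (\<lambda>x. poly q (g x)) X = polyop q (cfun g X)"
proof (induction q)
  case (pCons c q)
  have "continuous_on {a..b} (\<lambda>x. poly q (g x))" using g_cont by (intro continuous_intros)
  then show ?case
    using pCons
    by (simp add: polyop_pCons cfun_add[OF X] cfun_mult[OF X]
        cfun_const[OF X] g_cont continuous_on_mult)
qed (simp add: cfun_const[OF X])

lemma cfun_compose:
  assumes X: "X \<in> op_interval a b" and g_cont: "continuous_on {a..b} g"
    and range: "\<And>x. x \<in> {a..b} \<Longrightarrow> g x \<in> {c..d}" and f_cont: "continuous_on {c..d} f"
  shows "cfun f (cfun g X) = cfun (\<lambda>x. f (g x)) X"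
proof -
  obtain q where q_lim: "uniform_limit {c..d} (\<lambda>k x. poly (q k) x) f sequentially"
    using polynomial_approximation[OF f_cont] .
  have "(\<lambda>k. cfun (\<lambda>x. poly (q k) (g x)) X) \<longlonglongrightarrow> cfun f (cfun g X)"
    using tendsto_cfun[OF cfun_in_op_interval[OF X g_cont range] q_lim]
    by (simp add: cfun_poly_compose[OF X g_cont])
  moreover have "(\<lambda>k. cfun (\<lambda>x. poly (q k) (g x)) X) \<longlonglongrightarrow> cfun (\<lambda>x. f (g x)) X"
  proof (rule tendsto_cfun_uniform[OF X])
    show "continuous_on {a..b} (\<lambda>x. f (g x))" using continuous_on_compose2[OF f_cont g_cont] range
      by blast
    show "uniform_limit {a..b} (\<lambda>k x. poly (q k) (g x)) (\<lambda>x. f (g x)) sequentially"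
      by (rule uniform_limit_compose'[OF q_lim]) (use range in auto)
  qed (intro continuous_intros g_cont)
  ultimately show ?thesis by (rule LIMSEQ_unique)
qed

lemma cfun_scaleR:
  assumes X: "X \<in> op_interval a b" and "0 \<le> c" and f_cont: "continuous_on {c * a..c * b} f"
  shows "cfun f (c *\<^sub>R X) = cfun (\<lambda>x. f (c * x)) X"
proof -
  have "c *\<^sub>R X = cfun (\<lambda>x. c * x) X"
    using cfun_mult_left[OF X continuous_on_id, of c] by (simp add: cfun_ident[OF X])
  moreover have "c * x \<in> {c * a..c * b}" if "x \<in> {a..b}" for x
    using that \<open>0 \<le> c\<close> by (simp add: mult_left_mono)
  ultimately show ?thesis using cfun_compose[OF X _ _ f_cont, of "\<lambda>x. c * x"] by simp
qed

subsection \<open>Powers of positive invertible operators\<close>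

lemma posinv_positive: "posinv X \<Longrightarrow> positive_op X"
  by (simp add: posinv_def)

lemma posinv_self_adjoint: "posinv X \<Longrightarrow> self_adjoint X"
  by (simp add: posinv_def positive_op_def)

lemma posinv_op_interval:
  assumes "posinv X"
  obtains a b where "0 < a" "a \<le> b" "X \<in> op_interval a b"
proof -
  obtain B where B: "B o\<^sub>L X = id_blinfun" using assms by (auto simp: posinv_def invertible_op_def)
  have pos: "norm B + 1 > 0" by (simp add: add_nonneg_pos)
  have "1 / (norm B + 1) * norm x \<le> norm (X x)" for x
  proof -
    have "norm x = norm (B (X x))" using arg_cong[OF B, of "\<lambda>T. blinfun_apply T x"] by simp
    also have "\<dots> \<le> norm B * norm (X x)" by (rule norm_blinfun)
    also have "\<dots> \<le> (norm B + 1) * norm (X x)" by (simp add: algebra_simps)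
    finally show ?thesis using pos by (simp add: field_simps)
  qed
  then obtain a where a_bound: "0 < a" "loewner (a *\<^sub>R id_blinfun) X"
    using positive_op_bounded_below[OF posinv_positive[OF assms], of "1 / (norm B + 1)"] pos by auto
  have "loewner X (norm X *\<^sub>R id_blinfun)"
    by (rule loewnerI)
      (simp_all add: posinv_self_adjoint[OF assms] inner_blinfun_simps inner_blinfun_le_norm)
  with a_bound have "X \<in> op_interval a (norm X)" by (simp add: op_interval_def)
  then have "X \<in> op_interval a (max a (norm X))" by (rule op_interval_mono) auto
  then show thesis using that[of a "max a (norm X)"] a_bound(1) by simp
qed

lemma op_interval_posinv:
  assumes X: "X \<in> op_interval a b" and a_pos: "0 < a"
  shows "posinv X"
proof -
  have inv: "continuous_on {a..b} inverse" using a_pos by (intro continuous_intros) auto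
  have "cfun (\<lambda>x. x * inverse x) X = cfun (\<lambda>x. 1) X" "cfun (\<lambda>x. inverse x * x) X = cfun (\<lambda>x. 1) X"
    using a_pos by (intro cfun_cong[OF X] continuous_intros inv; simp)+
  then have "X o\<^sub>L cfun inverse X = id_blinfun" "cfun inverse X o\<^sub>L X = id_blinfun"
    using cfun_mult[OF X continuous_on_id inv] cfun_mult[OF X inv continuous_on_id]
    by (simp_all add: cfun_ident[OF X] cfun_const[OF X])
  moreover have "positive_op X"
    using positive_op_cfun[OF X continuous_on_id] a_pos by (simp add: cfun_ident[OF X])
  ultimately show ?thesis by (auto simp: posinv_def invertible_op_def)
qed

lemma posinv_common_interval:
  assumes "posinv X" "posinv Y"
  obtains a b where "0 < a" "a \<le> b" "X \<in> op_interval a b" "Y \<in> op_interval a b"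
proof -
  obtain a b where X: "0 < a" "a \<le> b" "X \<in> op_interval a b" using posinv_op_interval[OF assms(1)] .
  obtain c d where Y: "0 < c" "c \<le> d" "Y \<in> op_interval c d" using posinv_op_interval[OF assms(2)] .
  show thesis
  proof (rule that[of "min a c" "max b d"])
    show "X \<in> op_interval (min a c) (max b d)" by (rule op_interval_mono[OF X(3)]) auto
    show "Y \<in> op_interval (min a c) (max b d)" by (rule op_interval_mono[OF Y(3)]) auto
  qed (use X Y in auto)
qed

lemma continuous_on_powr_Icc: "0 < (a::real) \<Longrightarrow> continuous_on {a..b} (\<lambda>x. x powr r)"
  by (intro continuous_intros) auto

lemma continuous_on_opow: "0 < a \<Longrightarrow> continuous_on (op_interval a b) (\<lambda>X. opow X r)"
  using continuous_on_cfun[OF continuous_on_powr_Icc] unfolding opow_def .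

lemma self_adjoint_opow: "posinv X \<Longrightarrow> self_adjoint (opow X r)"
  unfolding opow_def
  by (erule posinv_op_interval) (erule self_adjoint_cfun, rule continuous_on_powr_Icc)

lemma opow_add:
  assumes "posinv X"
  shows "opow X (r + s) = opow X r o\<^sub>L opow X s"
proof -
  obtain a b where "0 < a" "X \<in> op_interval a b" using posinv_op_interval[OF assms] .
  then show ?thesis
    using cfun_mult[of X a b "\<lambda>x. x powr r" "\<lambda>x. x powr s"]
    by (simp add: opow_def powr_add continuous_on_powr_Icc)
qed

lemma opow_0:
  assumes "posinv X"
  shows "opow X 0 = id_blinfun"
proof -
  obtain a b where "0 < a" and X: "X \<in> op_interval a b" using posinv_op_interval[OF assms] .
  then show ?thesis
    using cfun_cong[OF X continuous_on_const, of 1 "\<lambda>x. x powr 0"]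
    by (simp add: opow_def cfun_const[OF X])
qed

lemma opow_1:
  assumes "posinv X"
  shows "opow X 1 = X"
proof -
  obtain a b where "0 < a" and X: "X \<in> op_interval a b" using posinv_op_interval[OF assms] .
  then show ?thesis
    using cfun_cong[OF X continuous_on_id, of "\<lambda>x. x powr 1"]
    by (simp add: opow_def cfun_ident[OF X])
qed

lemma opow_inverse:
  assumes "posinv X"
  shows "opow X r o\<^sub>L opow X (- r) = id_blinfun" "opow X (- r) o\<^sub>L opow X r = id_blinfun"
  using opow_add[OF assms, of r "- r"] opow_add[OF assms, of "- r" r] opow_0[OF assms] by simp_all

lemma opow_add_apply: "posinv X \<Longrightarrow> opow X r (opow X s x) = opow X (r + s) x"
  by (simp add: opow_add)

lemma opow_apply_inverse:
  assumes "posinv X"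
  shows "opow X r (opow X (- r) x) = x" "opow X (- r) (opow X r x) = x"
  by (simp_all add: opow_add_apply opow_0 assms)

lemma posinv_opow:
  assumes "posinv X"
  shows "posinv (opow X r)"
proof -
  obtain a b where a_pos: "0 < a" and X: "X \<in> op_interval a b" using posinv_op_interval[OF assms] .
  have "positive_op (opow X r)"
    unfolding opow_def by (rule positive_op_cfun[OF X continuous_on_powr_Icc[OF a_pos]]) simp
  then show ?thesis
    using opow_inverse[OF assms] by (auto simp: posinv_def invertible_op_def)
qed

lemma opow_opow:
  assumes "posinv X"
  shows "opow (opow X r) s = opow X (r * s)"
proof -
  obtain a b where ab: "0 < a" "a \<le> b"
    and X: "X \<in> op_interval a b" using posinv_op_interval[OF assms] .
  define c d where "c = min (a powr r) (b powr r)" and "d = max (a powr r) (b powr r)"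
  have "0 < c" using ab by (simp add: c_def)
  moreover have "x powr r \<in> {c..d}" if "x \<in> {a..b}" for x
    using that ab powr_mono2[of r a x] powr_mono2[of r x b] powr_mono2'[of r a x]
      powr_mono2'[of r x b]
    by (cases "0 \<le> r") (auto simp: c_def d_def)
  ultimately have "cfun (\<lambda>x. x powr s) (cfun (\<lambda>x. x powr r) X) = cfun (\<lambda>x. (x powr r) powr s) X"
    by (intro cfun_compose[OF X] continuous_on_powr_Icc ab)
  then show ?thesis by (simp add: opow_def powr_powr)
qed

lemma opow_scaleR:
  assumes "posinv X" "0 < c"
  shows "opow (c *\<^sub>R X) r = c powr r *\<^sub>R opow X r"
proof -
  obtain a b where a_pos: "0 < a"
    and X: "X \<in> op_interval a b" using posinv_op_interval[OF assms(1)] .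
  have "opow (c *\<^sub>R X) r = cfun (\<lambda>x. (c * x) powr r) X"
    unfolding opow_def
    using assms(2)
    by (intro cfun_scaleR[OF X _ continuous_on_powr_Icc[OF mult_pos_pos[OF _ a_pos]]]) simp_all
  also have "\<dots> = cfun (\<lambda>x. c powr r * x powr r) X"
    using a_pos assms(2) by (intro cfun_cong[OF X]) (auto intro!: continuous_intros simp: powr_mult)
  also have "\<dots> = c powr r *\<^sub>R opow X r"
    unfolding opow_def by (rule cfun_mult_left[OF X continuous_on_powr_Icc[OF a_pos]])
  finally show ?thesis .
qed

lemma posinv_scaleR:
  assumes "posinv X" "0 < c"
  shows "posinv (c *\<^sub>R X)"
proof -
  obtain a b where "0 < a" "X \<in> op_interval a b" using posinv_op_interval[OF assms(1)] .
  then show ?thesis using assms(2)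
    by (intro op_interval_posinv[OF op_interval_scaleR mult_pos_pos]) simp_all
qed

lemma opow_intertwine:
  assumes "posinv X" "posinv Y" "Z o\<^sub>L X = Y o\<^sub>L Z"
  shows "Z o\<^sub>L opow X r = opow Y r o\<^sub>L Z"
proof -
  obtain a b where "0 < a" "X \<in> op_interval a b" "Y \<in> op_interval a b"
    using posinv_common_interval[OF assms(1,2)] .
  then show ?thesis
    unfolding opow_def using cfun_intertwine[OF _ _ continuous_on_powr_Icc assms(3)] by blast
qed

lemma opow_id: "opow (id_blinfun :: 'a::{real_inner,complete_space} op) r = id_blinfun"
proof -
  have id_in: "(id_blinfun :: 'a op) \<in> op_interval 1 1" by (simp add: op_interval_def)
  have "cfun (\<lambda>x. x powr r) (id_blinfun :: 'a op) = cfun (\<lambda>x. 1) id_blinfun"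
    by (rule cfun_cong[OF id_in continuous_on_powr_Icc]) auto
  then show ?thesis by (simp add: opow_def cfun_const[OF id_in])
qed

lemma opow_minus_one_in_op_interval:
  assumes X: "X \<in> op_interval a b" and a_pos: "0 < a"
  shows "opow X (-1) \<in> op_interval (1 / b) (1 / a)"
  unfolding opow_def using a_pos
  by (intro cfun_in_op_interval[OF X continuous_on_powr_Icc[OF a_pos]])
    (auto simp: powr_minus field_simps)

lemma opow_minus_one_simps:
  assumes "posinv A"
  shows "opow A (-1) (A x) = x" "A (opow A (-1) x) = x"
  using opow_apply_inverse[OF assms, of 1 x] by (simp_all add: opow_1 assms)

lemma opow_minus_one_eqI:
  fixes A B :: "'a::{real_inner,complete_space} op"
  assumes "posinv A" "\<And>x. A (B x) = x"
  shows "opow A (-1) = B"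
  by (rule blinfun_eqI) (metis assms opow_minus_one_simps(1))

lemma sandwich_opow: "posinv X \<Longrightarrow> sandwich (opow X r) (opow X s) = opow X (2 * r + s)"
  by (rule blinfun_eqI) (simp add: opow_add_apply algebra_simps)

lemma sandwich_opow_cancel:
  assumes "posinv X"
  shows "sandwich (opow X r) (sandwich (opow X (- r)) A) = A"
  by (rule blinfun_eqI) (simp add: opow_apply_inverse[OF assms])

lemma posinv_sandwich_opow:
  assumes A: "posinv A" and B: "posinv B"
  shows "posinv (sandwich (opow A r) B)"
proof -
  let ?inverse = "sandwich (opow A (- r)) (opow B (-1))"
  have "sandwich (opow A r) B o\<^sub>L ?inverse = id_blinfun"
    "?inverse o\<^sub>L sandwich (opow A r) B = id_blinfun"
    by (rule blinfun_eqI, simp add: opow_apply_inverse[OF A] opow_minus_one_simps[OF B])+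
  then show ?thesis
    using positive_op_sandwich[OF self_adjoint_opow[OF A] posinv_positive[OF B]]
    unfolding posinv_def invertible_op_def by blast
qed

lemma norm_opow_half:
  assumes "posinv X"
  shows "(norm (opow X (s / 2) x))\<^sup>2 = opow X s x \<bullet> x"
  using self_adjointD[OF self_adjoint_opow[OF assms], of "s / 2" "opow X (s / 2) x" x]
  by (simp add: power2_norm_eq_inner opow_add_apply[OF assms])

lemma uniform_limit_powr_exponent:
  assumes a_pos: "0 < (a::real)"
  shows "uniform_limit {a..b} (\<lambda>s x. x powr s) (\<lambda>x. x powr s\<^sub>0) (at s\<^sub>0)"
proof (rule uniform_limitI)
  fix e :: real assume "0 < e"
  have "continuous_on (UNIV \<times> {a..b}) (\<lambda>(s, x). x powr s)"
    using a_pos unfolding split_beta by (intro continuous_intros) auto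
  then obtain U where U: "s\<^sub>0 \<in> U" "open U"
    "\<forall>s\<in>U \<inter> UNIV. \<forall>x\<in>{a..b}. dist (x powr s) (x powr s\<^sub>0) \<le> e / 2"
    using continuous_on_prod_compactE[of UNIV "{a..b}" "\<lambda>(s, x). x powr s" s\<^sub>0 "e / 2"] \<open>0 < e\<close>
    by auto
  have "\<forall>\<^sub>F s in at s\<^sub>0. s \<in> U" using U by (intro eventually_at_topological[THEN iffD2]) blast
  then show "\<forall>\<^sub>F s in at s\<^sub>0. \<forall>x\<in>{a..b}. dist (x powr s) (x powr s\<^sub>0) < e"
    by eventually_elim (use U(3) \<open>0 < e\<close> in force)
qed

lemma continuous_on_opow_exponent:
  assumes "posinv X"
  shows "continuous_on UNIV (opow X)"
proof -
  obtain a b where "0 < a" and X: "X \<in> op_interval a b" using posinv_op_interval[OF assms] .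
  then show ?thesis
    unfolding continuous_on_def opow_def
    by (intro ballI tendsto_cfun_uniform[OF X] continuous_on_powr_Icc uniform_limit_powr_exponent)
qed

subsection \<open>The Loewner--Heinz inequality\<close>

lemma opow_minus_one_antimono:
  assumes X: "posinv X" and Y: "posinv Y" and X_le_Y: "loewner X Y"
  shows "loewner (opow Y (-1)) (opow X (-1))"
proof (rule loewnerI)
  fix x
  define y z where "y = opow Y (-1) x" and "z = opow X (-1) x"
  have Yy: "Y y = x" and Xz: "X z = x"
    by (simp_all add: y_def z_def opow_minus_one_simps X Y)
  have nonneg: "0 \<le> x \<bullet> y" "0 \<le> x \<bullet> z"
    using positive_opD(2)[OF posinv_positive[OF Y], of y]
      positive_opD(2)[OF posinv_positive[OF X], of z]
    by (simp_all add: Yy Xz)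
  have "X y \<bullet> z = x \<bullet> y"
    using self_adjointD[OF posinv_self_adjoint[OF X], of y z] by (simp add: Xz inner_commute)
  then have "(x \<bullet> y)\<^sup>2 \<le> (X y \<bullet> y) * (x \<bullet> z)"
    using positive_op_Cauchy_Schwarz[OF posinv_positive[OF X], of y z] by (simp add: Xz)
  also have "\<dots> \<le> (x \<bullet> y) * (x \<bullet> z)"
    using loewnerD[OF X_le_Y, of y] nonneg by (simp add: Yy mult_right_mono)
  finally have "x \<bullet> y \<le> x \<bullet> z"
    using nonneg by (cases "x \<bullet> y = 0") (simp_all add: power2_eq_square)
  then show "opow Y (-1) x \<bullet> x \<le> opow X (-1) x \<bullet> x"
    by (simp add: y_def z_def inner_commute)
qed (intro self_adjoint_opow X Y)+

definition form_inf :: "'a::real_inner op \<Rightarrow> real" where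
  "form_inf T = Inf ((\<lambda>x. T x \<bullet> x) ` sphere 0 1)"

lemma bdd_below_form: "bdd_below ((\<lambda>x. T x \<bullet> x) ` sphere 0 1)" for T :: "'a::real_inner op"
proof (rule bdd_belowI2)
  show "- norm T \<le> T x \<bullet> x" if "x \<in> sphere 0 1" for x
    using inner_blinfun_le_norm[of "- T" x] that by (simp add: blinfun.minus_left)
qed

lemma form_inf_le: "form_inf T * (norm x)\<^sup>2 \<le> T x \<bullet> x"
proof (cases "x = 0")
  case False
  define u where "u = x /\<^sub>R norm x"
  have "u \<in> sphere 0 1" using False by (simp add: u_def)
  then have "form_inf T * (norm x)\<^sup>2 \<le> (T u \<bullet> u) * (norm x)\<^sup>2"
    unfolding form_inf_def by (intro mult_right_mono cInf_lower bdd_below_form) auto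
  also have "\<dots> = T x \<bullet> x"
    using False by (simp add: u_def blinfun.bilinear_simps power2_eq_square field_simps)
  finally show ?thesis .
qed simp

lemma form_inf_approximate_eigenvector:
  fixes T :: "'a::{real_inner,complete_space} op"
  assumes T: "self_adjoint T" and "0 < e" and nontrivial: "(x\<^sub>0::'a) \<noteq> 0"
  obtains x where "norm x = 1" "norm (T x - form_inf T *\<^sub>R x) < e"
proof -
  define S where "S = T - form_inf T *\<^sub>R id_blinfun"
  have S: "positive_op S"
    using T form_inf_le[of T] by (simp add: S_def positive_op_def inner_blinfun_simps)
  have pos: "norm S + 1 > 0" by (simp add: add_nonneg_pos)
  have "x\<^sub>0 /\<^sub>R norm x\<^sub>0 \<in> sphere 0 1" using nontrivial by simp
  then have "(\<lambda>x. T x \<bullet> x) ` sphere 0 1 \<noteq> {}" by blast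
  moreover have "form_inf T < form_inf T + e\<^sup>2 / (norm S + 1)" using \<open>0 < e\<close> pos by simp
  ultimately obtain x where x: "norm x = 1" "T x \<bullet> x < form_inf T + e\<^sup>2 / (norm S + 1)"
    unfolding form_inf_def by (metis (no_types, lifting) cInf_lessD imageE mem_sphere_0)
  have "(norm (S x))\<^sup>2 \<le> norm S * (S x \<bullet> x)" by (rule norm_positive_op_apply[OF S])
  also have "\<dots> \<le> norm S * (e\<^sup>2 / (norm S + 1))"
    using x by (intro mult_left_mono) (simp_all add: S_def inner_blinfun_simps)
  also have "\<dots> < e\<^sup>2" using \<open>0 < e\<close> pos by (simp add: field_simps)
  finally have "norm (S x) < e" using \<open>0 < e\<close> by (simp add: power2_less_imp_less)
  then show thesis using that[of x] x(1) by (simp add: S_def blinfun.bilinear_simps)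
qed

lemma positive_op_norm_shift_ge:
  assumes A: "positive_op A" and "\<alpha> \<le> 0"
  shows "(norm (A x))\<^sup>2 + \<alpha>\<^sup>2 * (norm x)\<^sup>2 \<le> (norm (A x - \<alpha> *\<^sub>R x))\<^sup>2"
proof -
  have "(norm (A x - \<alpha> *\<^sub>R x))\<^sup>2 = (norm (A x))\<^sup>2 - 2 * \<alpha> * (A x \<bullet> x) + \<alpha>\<^sup>2 * (norm x)\<^sup>2"
    unfolding power2_norm_eq_inner
    by (simp add: inner_simps inner_commute[of x "A x"] power2_eq_square right_diff_distrib)
  moreover have "\<alpha> * (A x \<bullet> x) \<le> 0"
    using positive_opD(2)[OF A] \<open>\<alpha> \<le> 0\<close> by (simp add: mult_nonpos_nonneg)
  ultimately show ?thesis by simp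
qed

text \<open>Were \<open>A - S\<close> not positive, \<open>S x\<close> would be close to \<open>A x - \<alpha> x\<close> for some \<open>\<alpha> < 0\<close> and a unit
  vector \<open>x\<close>, hence longer than \<open>A x\<close>.\<close>

lemma loewner_of_square_le:
  assumes S: "self_adjoint S" and A: "positive_op A" and squares: "loewner (S o\<^sub>L S) (A o\<^sub>L A)"
  shows "loewner S A"
proof (rule loewnerI)
  fix y
  define \<alpha> where "\<alpha> = form_inf (A - S)"
  show "S y \<bullet> y \<le> A y \<bullet> y"
  proof (rule ccontr)
    assume "\<not> S y \<bullet> y \<le> A y \<bullet> y"
    then have "(A - S) y \<bullet> y < 0" by (simp add: blinfun.diff_left inner_diff_left)
    then have "\<alpha> * (norm y)\<^sup>2 < 0" using form_inf_le[of "A - S" y] by (simp add: \<alpha>_def)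
    then have "\<alpha> < 0" "y \<noteq> 0" by (auto simp: mult_less_0_iff)
    have "\<alpha>\<^sup>2 \<le> 0 + e" if "0 < e" for e
    proof -
      define \<epsilon> where "\<epsilon> = min 1 (e / (2 * norm A + 1))"
      have pos: "2 * norm A + 1 > 0" by (simp add: add_nonneg_pos)
      then have "0 < \<epsilon>" "\<epsilon> \<le> 1" using that by (simp_all add: \<epsilon>_def)
      obtain x where x: "norm x = 1" "norm ((A - S) x - \<alpha> *\<^sub>R x) < \<epsilon>"
        unfolding \<alpha>_def using S positive_opD(1)[OF A] \<open>0 < \<epsilon>\<close> \<open>y \<noteq> 0\<close>
        by (meson form_inf_approximate_eigenvector self_adjoint_diff)
      have "norm (A x - \<alpha> *\<^sub>R x) \<le> norm (S x) + norm ((A - S) x - \<alpha> *\<^sub>R x)"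
        using norm_triangle_ineq[of "S x" "(A - S) x - \<alpha> *\<^sub>R x"] by (simp add: blinfun.diff_left)
      moreover have "norm (S x) \<le> norm (A x)"
        using loewnerD[OF squares, of x] self_adjointD[OF S, of "S x" x]
          self_adjointD[OF positive_opD(1)[OF A], of "A x" x] by (simp add: norm_le)
      ultimately have "norm (A x - \<alpha> *\<^sub>R x) \<le> norm (A x) + \<epsilon>" using x(2) by linarith
      then have "(norm (A x - \<alpha> *\<^sub>R x))\<^sup>2 \<le> (norm (A x) + \<epsilon>)\<^sup>2" by (rule power_mono) simp
      then have "\<alpha>\<^sup>2 \<le> \<epsilon> * (2 * norm (A x) + \<epsilon>)"
        using positive_op_norm_shift_ge[OF A, of \<alpha> x] \<open>\<alpha> < 0\<close> x(1)
        by (simp add: power2_eq_square algebra_simps)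
      also have "\<dots> \<le> e / (2 * norm A + 1) * (2 * norm A + 1)"
        using norm_blinfun[of A x] x(1) \<open>0 < \<epsilon>\<close> \<open>\<epsilon> \<le> 1\<close>
        by (intro mult_mono add_mono) (simp_all add: \<epsilon>_def)
      finally show ?thesis using pos by simp
    qed
    then have "\<alpha>\<^sup>2 \<le> 0" by (rule field_le_epsilon)
    then show False using \<open>\<alpha> < 0\<close> by simp
  qed
qed (use S positive_opD(1)[OF A] in auto)

text \<open>The operator \<open>S = Y\<^sup>-\<^sup>s\<^sup>/\<^sup>2 X\<^sup>r Y\<^sup>-\<^sup>s\<^sup>/\<^sup>2\<close> with \<open>r = (s + t) / 2\<close> satisfies \<open>S\<^sup>2 \<le> Y\<^sup>t\<^sup>-\<^sup>s\<close>, because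
  \<open>X\<^sup>r Y\<^sup>-\<^sup>s X\<^sup>r \<le> X\<^sup>r X\<^sup>-\<^sup>s X\<^sup>r = X\<^sup>t\<close>.\<close>

lemma opow_mono_midpoint:
  assumes X: "posinv X" and Y: "posinv Y"
    and le_at_s: "loewner (opow X s) (opow Y s)" and le_at_t: "loewner (opow X t) (opow Y t)"
  shows "loewner (opow X ((s + t) / 2)) (opow Y ((s + t) / 2))"
proof -
  let ?r = "(s + t) / 2"
  define S where "S = sandwich (opow Y (- (s / 2))) (opow X ?r)"
  note sa = self_adjoint_opow[OF X] self_adjoint_opow[OF Y]
  have "loewner (opow Y (- s)) (opow X (- s))"
    using opow_minus_one_antimono[OF posinv_opow[OF X] posinv_opow[OF Y] le_at_s]
    by (simp add: opow_opow X Y)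
  then have "loewner (sandwich (opow X ?r) (opow Y (- s))) (sandwich (opow X ?r) (opow X (- s)))"
    by (rule loewner_sandwich[OF sa(1)])
  also have "sandwich (opow X ?r) (opow X (- s)) = opow X t"
    by (simp add: sandwich_opow[OF X] add_divide_distrib)
  also note le_at_t
  finally have "loewner (sandwich (opow Y (- (s / 2))) (sandwich (opow X ?r) (opow Y (- s))))
      (sandwich (opow Y (- (s / 2))) (opow Y t))"
    by (rule loewner_sandwich[OF sa(2)])
  also have "sandwich (opow Y (- (s / 2))) (sandwich (opow X ?r) (opow Y (- s))) = S o\<^sub>L S"
    using opow_add_apply[OF Y, of "- (s / 2)" "- (s / 2)"] by (intro blinfun_eqI) (simp add: S_def)
  also have "sandwich (opow Y (- (s / 2))) (opow Y t)
      = opow Y ((t - s) / 2) o\<^sub>L opow Y ((t - s) / 2)"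
    by (simp add: sandwich_opow[OF Y] opow_add[OF Y, symmetric])
  finally have "loewner (S o\<^sub>L S) (opow Y ((t - s) / 2) o\<^sub>L opow Y ((t - s) / 2))" .
  moreover have "self_adjoint S" unfolding S_def by (intro self_adjoint_sandwich sa)
  ultimately have "loewner S (opow Y ((t - s) / 2))"
    using loewner_of_square_le posinv_positive[OF posinv_opow[OF Y]] by blast
  then have "loewner (sandwich (opow Y (s / 2)) S)
      (sandwich (opow Y (s / 2)) (opow Y ((t - s) / 2)))"
    by (rule loewner_sandwich[OF sa(2)])
  moreover have "2 * (s / 2) + (t - s) / 2 = ?r" by (simp add: field_simps)
  then have "sandwich (opow Y (s / 2)) (opow Y ((t - s) / 2)) = opow Y ?r"
    by (simp only: sandwich_opow[OF Y])
  ultimately show ?thesis by (simp add: S_def sandwich_opow_cancel[OF Y])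
qed

lemma closed_midpoint_convex_imp_Icc_subset:
  fixes S :: "real set"
  assumes "closed S" and ab_in: "a \<in> S" "b \<in> S"
    and midpoint: "\<And>x y. x \<in> S \<Longrightarrow> y \<in> S \<Longrightarrow> (x + y) / 2 \<in> S"
  shows "{a..b} \<subseteq> S"
proof
  fix t assume t_in: "t \<in> {a..b}"
  have "compact (S \<inter> {a..t})" "compact (S \<inter> {t..b})"
    by (intro closed_Int_compact[OF \<open>closed S\<close>] compact_Icc)+
  moreover have "S \<inter> {a..t} \<noteq> {}" "S \<inter> {t..b} \<noteq> {}" using ab_in t_in by auto
  ultimately obtain l u
    where l_max: "l \<in> S \<inter> {a..t}" "\<And>x. x \<in> S \<inter> {a..t} \<Longrightarrow> x \<le> l"
      and u_min: "u \<in> S \<inter> {t..b}" "\<And>x. x \<in> S \<inter> {t..b} \<Longrightarrow> u \<le> x"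
    using compact_attains_sup compact_attains_inf by metis
  have "(l + u) / 2 \<in> S" using midpoint l_max(1) u_min(1) by blast
  then have "(l + u) / 2 \<le> l \<or> u \<le> (l + u) / 2"
    using l_max(1) u_min(1) l_max(2)[of "(l + u) / 2"] u_min(2)[of "(l + u) / 2"]
    by (cases "(l + u) / 2 \<le> t") auto
  then have "t = l" using l_max(1) u_min(1) by auto
  then show "t \<in> S" using l_max(1) by blast
qed

theorem Loewner_Heinz:
  assumes X: "posinv X" and Y: "posinv Y" and X_le_Y: "loewner X Y" and t_range: "0 \<le> t" "t \<le> 1"
  shows "loewner (opow X t) (opow Y t)"
proof -
  let ?S = "{s. loewner (opow X s) (opow Y s)}"
  have "closed ?S"
    unfolding closed_sequential_limits
  proof (intro allI impI, elim conjE)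
    fix \<sigma> s assume \<sigma>: "\<forall>n. \<sigma> n \<in> ?S" and "\<sigma> \<longlonglongrightarrow> s"
    then have "(\<lambda>n. opow Z (\<sigma> n)) \<longlonglongrightarrow> opow Z s" if "posinv Z" for Z :: "'a op"
      using continuous_on_tendsto_compose[OF continuous_on_opow_exponent[OF that]] by simp
    from loewner_limit[OF _ this[OF X] this[OF Y]] show "s \<in> ?S" using \<sigma> by simp
  qed
  moreover have "0 \<in> ?S" "1 \<in> ?S" using X_le_Y by (simp_all add: opow_0 opow_1 X Y)
  ultimately have "{0..1} \<subseteq> ?S"
    by (rule closed_midpoint_convex_imp_Icc_subset) (simp add: opow_mono_midpoint X Y)
  then show ?thesis using t_range by auto
qed

subsection \<open>The weighted geometric mean of two operators\<close>

lemma sharp_altdef: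
  "sharp t A B = sandwich (opow A (1/2)) (opow (sandwich (opow A (- (1/2))) B) t)"
  by (simp add: sharp_def sandwich_def)

lemma posinv_sharp: "posinv A \<Longrightarrow> posinv B \<Longrightarrow> posinv (sharp t A B)"
  unfolding sharp_altdef by (intro posinv_sandwich_opow posinv_opow)

lemma sandwich_opow_self:
  assumes "posinv A"
  shows "sandwich (opow A (- (1/2))) A = id_blinfun" "sandwich (opow A (1/2)) id_blinfun = A"
  using sandwich_opow[OF assms, of "- (1/2)" 1] sandwich_opow[OF assms, of "1/2" 0]
  by (simp_all add: opow_0 opow_1 assms)

lemma sharp_same: "posinv A \<Longrightarrow> sharp t A A = A"
  by (simp add: sharp_altdef sandwich_opow_self opow_id)

lemma opow_minus_one_sandwich:
  assumes A: "posinv A" and B: "posinv B"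
  shows "opow (sandwich (opow A r) B) (-1) = sandwich (opow A (- r)) (opow B (-1))"
  by (rule opow_minus_one_eqI[OF posinv_sandwich_opow[OF A B]])
    (simp add: opow_apply_inverse[OF A] opow_minus_one_simps[OF B])

lemma opow_minus_one_sharp:
  assumes A: "posinv A" and B: "posinv B"
  shows "opow (sharp t A B) (-1) = sharp t (opow A (-1)) (opow B (-1))"
proof -
  define X where "X = sandwich (opow A (- (1/2))) B"
  have X: "posinv X" unfolding X_def by (rule posinv_sandwich_opow[OF A B])
  have "opow (sharp t A B) (-1) = sandwich (opow A (- (1/2))) (opow (opow X t) (-1))"
    unfolding sharp_altdef X_def[symmetric]
    by (rule opow_minus_one_sandwich[OF A posinv_opow[OF X]])
  also have "opow (opow X t) (-1) = opow (opow X (-1)) t"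
    by (simp add: opow_opow[OF X])
  also have "opow X (-1) = sandwich (opow A (1/2)) (opow B (-1))"
    by (simp add: X_def opow_minus_one_sandwich[OF A B])
  finally show ?thesis by (simp add: sharp_altdef opow_opow[OF A])
qed

lemma opow_half_simps:
  assumes "posinv A"
  shows "opow A (1/2) (opow A (1/2) x) = A x"
    and "opow A (1/2) (opow A (- (1/2)) x) = x"
    and "opow A (- (1/2)) (opow A (1/2) x) = x"
    and "opow A (- (1/2)) (A x) = opow A (1/2) x"
    and "A (opow A (- (1/2)) x) = opow A (1/2) x"
proof -
  show half: "opow A (1/2) (opow A (1/2) x) = A x" for x
    by (simp add: opow_add_apply opow_1 assms)
  show inverse: "opow A (1/2) (opow A (- (1/2)) x) = x"
    "opow A (- (1/2)) (opow A (1/2) x) = x" for x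
    by (simp_all add: opow_add_apply opow_0 assms)
  show "opow A (- (1/2)) (A x) = opow A (1/2) x" "A (opow A (- (1/2)) x) = opow A (1/2) x"
    by (simp_all only: half[symmetric] inverse)
qed

text \<open>Both sides are \<open>A\<^sup>1\<^sup>/\<^sup>2 X\<^sup>t A\<^sup>1\<^sup>/\<^sup>2\<close> for \<open>X = A\<^sup>-\<^sup>1\<^sup>/\<^sup>2 B A\<^sup>-\<^sup>1\<^sup>/\<^sup>2\<close>, because \<open>Z = A\<^sup>-\<^sup>1\<^sup>/\<^sup>2 B\<^sup>1\<^sup>/\<^sup>2\<close> intertwines
  \<open>Y = B\<^sup>-\<^sup>1\<^sup>/\<^sup>2 A B\<^sup>-\<^sup>1\<^sup>/\<^sup>2\<close> with \<open>X\<^sup>-\<^sup>1\<close>.\<close>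

lemma sharp_swap:
  assumes A: "posinv A" and B: "posinv B"
  shows "sharp t A B = sharp (1 - t) B A"
proof -
  define X where "X = sandwich (opow A (- (1/2))) B"
  define Y where "Y = sandwich (opow B (- (1/2))) A"
  define Z where "Z = opow A (- (1/2)) o\<^sub>L opow B (1/2)"
  note half = opow_half_simps[OF A] opow_half_simps[OF B]
  have X: "posinv X" and Y: "posinv Y"
    unfolding X_def Y_def by (intro posinv_sandwich_opow A B)+
  have "X (Z (Y x)) = Z x" for x
    by (simp add: X_def Y_def Z_def half)
  then have "Z o\<^sub>L Y = opow X (-1) o\<^sub>L Z"
    by (intro blinfun_eqI) (simp, metis opow_minus_one_simps(1)[OF X])
  from opow_intertwine[OF Y posinv_opow[OF X] this, of "1 - t"]
  have "Z o\<^sub>L opow Y (1 - t) = opow X (t - 1) o\<^sub>L Z"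
    by (simp add: opow_opow[OF X])
  then have ZY: "Z (opow Y (1 - t) x) = opow X (t - 1) (Z x)" for x
    by (metis blinfun_apply_blinfun_compose)
  have AZ: "opow A (1/2) (Z x) = opow B (1/2) x"
    and ZB: "Z (opow B (1/2) x) = X (opow A (1/2) x)" for x
    by (simp_all add: Z_def X_def half)
  show ?thesis
  proof (rule blinfun_eqI)
    fix x
    have "sharp (1 - t) B A x = opow A (1/2) (Z (opow Y (1 - t) (opow B (1/2) x)))"
      by (simp add: sharp_altdef Y_def[symmetric] AZ)
    also have "\<dots> = opow A (1/2) (opow X (t - 1) (opow X 1 (opow A (1/2) x)))"
      by (simp add: ZY ZB opow_1[OF X])
    also have "\<dots> = sharp t A B x"
      by (simp add: opow_add_apply[OF X] sharp_altdef X_def[symmetric])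
    finally show "sharp t A B x = sharp (1 - t) B A x" by simp
  qed
qed

lemma sharp_mono:
  assumes pos: "posinv A" "posinv B" "posinv C" "posinv D" and AC_BD: "loewner A C" "loewner B D"
    and t_range: "0 \<le> t" "t \<le> 1"
  shows "loewner (sharp t A B) (sharp t C D)"
proof -
  have mono_right: "loewner (sharp s P Q) (sharp s P R)"
    if "posinv P" "posinv Q" "posinv R" "loewner Q R" "0 \<le> s" "s \<le> 1" for s and P Q R :: "'a op"
    unfolding sharp_altdef
    by (intro loewner_sandwich Loewner_Heinz posinv_sandwich_opow self_adjoint_opow that)
  have "loewner (sharp t A B) (sharp t A D)" by (intro mono_right pos AC_BD t_range)
  also have "sharp t A D = sharp (1 - t) D A" by (intro sharp_swap pos)
  also have "loewner (sharp (1 - t) D A) (sharp (1 - t) D C)"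
    using t_range by (intro mono_right pos AC_BD) simp_all
  also have "sharp (1 - t) D C = sharp t C D" by (intro sharp_swap[symmetric] pos)
  finally show ?thesis .
qed

lemma sharp_scaleR:
  assumes A: "posinv A" and B: "posinv B" and "0 < a" "0 < b"
  shows "sharp t (a *\<^sub>R A) (b *\<^sub>R B) = (a powr (1 - t) * b powr t) *\<^sub>R sharp t A B"
proof -
  have scale_right: "sharp s P (c *\<^sub>R Q) = c powr s *\<^sub>R sharp s P Q"
    if "posinv P" "posinv Q" "0 < c" for s c and P Q :: "'a op"
    by (simp add: sharp_altdef sandwich_scaleR opow_scaleR posinv_sandwich_opow that)
  have "sharp t (a *\<^sub>R A) (b *\<^sub>R B) = b powr t *\<^sub>R sharp (1 - t) B (a *\<^sub>R A)"
    using assms by (simp add: scale_right posinv_scaleR sharp_swap[of "a *\<^sub>R A" B])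
  also have "\<dots> = (a powr (1 - t) * b powr t) *\<^sub>R sharp t A B"
    using assms by (simp add: scale_right sharp_swap[of A B])
  finally show ?thesis .
qed

lemma wam2_same: "wam2 t X X = X"
  by (simp add: wam2_def scaleR_add_left[symmetric])

lemma wam2_mono:
  "loewner A C \<Longrightarrow> loewner B D \<Longrightarrow> 0 \<le> t \<Longrightarrow> t \<le> 1 \<Longrightarrow> loewner (wam2 t A B) (wam2 t C D)"
  unfolding wam2_def by (intro loewner_add loewner_scaleR) simp_all

lemma opow_le_wam2_id:
  assumes "posinv X" and t_range: "0 \<le> t" "t \<le> 1"
  shows "loewner (opow X t) (wam2 t id_blinfun X)"
proof -
  obtain a b where a_pos: "0 < a"
    and X: "X \<in> op_interval a b" using posinv_op_interval[OF assms(1)] .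
  have linear: "continuous_on {a..b} (\<lambda>x. (1 - t) + t * x)" by (intro continuous_intros)
  have "loewner (opow X t) (cfun (\<lambda>x. (1 - t) + t * x) X)"
    unfolding opow_def
  proof (rule cfun_mono[OF X continuous_on_powr_Icc[OF a_pos] linear])
    show "x powr t \<le> (1 - t) + t * x" if "x \<in> {a..b}" for x
      using Youngs_inequality_0[of "1 - t" t 1 x] that a_pos t_range by simp
  qed
  also have "cfun (\<lambda>x. (1 - t) + t * x) X = polyop [:1 - t, t:] X"
    using cfun_poly[OF X, of "[:1 - t, t:]"] by (simp add: mult.commute)
  finally show ?thesis by (simp add: polyop_linear wam2_def)
qed

lemma sharp_le_wam2:
  assumes A: "posinv A" and B: "posinv B" and t_range: "0 \<le> t" "t \<le> 1"
  shows "loewner (sharp t A B) (wam2 t A B)"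
proof -
  let ?X = "sandwich (opow A (- (1/2))) B"
  have "loewner (sharp t A B) (sandwich (opow A (1/2)) (wam2 t id_blinfun ?X))"
    unfolding sharp_altdef
    by (intro loewner_sandwich opow_le_wam2_id posinv_sandwich_opow self_adjoint_opow A B t_range)
  also have "sandwich (opow A (1/2)) (wam2 t id_blinfun ?X) = wam2 t A B"
    by (simp add: wam2_def sandwich_add sandwich_scaleR sandwich_opow_self[OF A]
        sandwich_opow_cancel[OF A])
  finally show ?thesis .
qed

lemma wam2_in_op_interval:
  assumes "A \<in> op_interval a b" "B \<in> op_interval a b" "0 \<le> t" "t \<le> 1"
  shows "wam2 t A B \<in> op_interval a b"
  using wam2_mono[of "a *\<^sub>R id_blinfun" A "a *\<^sub>R id_blinfun" B t]
    wam2_mono[of A "b *\<^sub>R id_blinfun" B "b *\<^sub>R id_blinfun" t] assms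
  by (simp add: op_interval_def wam2_same)

lemma sharp_in_op_interval:
  assumes A: "A \<in> op_interval a b" and B: "B \<in> op_interval a b" and ab: "0 < a" "a \<le> b"
    and t_range: "0 \<le> t" "t \<le> 1"
  shows "sharp t A B \<in> op_interval a b"
proof -
  have bounds: "posinv (a *\<^sub>R id_blinfun :: 'a op)" "posinv (b *\<^sub>R id_blinfun :: 'a op)"
    using ab op_interval_posinv[of "a *\<^sub>R id_blinfun" a a]
      op_interval_posinv[of "b *\<^sub>R id_blinfun" b b]
    by (simp_all add: op_interval_def)
  have AB_bounds: "loewner (a *\<^sub>R id_blinfun) A" "loewner (a *\<^sub>R id_blinfun) B"
    "loewner A (b *\<^sub>R id_blinfun)" "loewner B (b *\<^sub>R id_blinfun)"
    using A B by (simp_all add: op_interval_def)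
  note pos = op_interval_posinv[OF A ab(1)] op_interval_posinv[OF B ab(1)]
  have "loewner (sharp t (a *\<^sub>R id_blinfun) (a *\<^sub>R id_blinfun)) (sharp t A B)"
    "loewner (sharp t A B) (sharp t (b *\<^sub>R id_blinfun) (b *\<^sub>R id_blinfun))"
    by (intro sharp_mono bounds pos AB_bounds t_range)+
  then show ?thesis by (simp add: op_interval_def sharp_same bounds)
qed

subsection \<open>The Thompson metric\<close>

lemma op_interval_ratio:
  assumes X: "X \<in> op_interval a b" and Y: "Y \<in> op_interval a b" and ab: "0 < a" "a \<le> b"
  shows "loewner X ((b / a) *\<^sub>R Y)"
proof -
  have "loewner X (b *\<^sub>R id_blinfun)" using X by (simp add: op_interval_def)
  also have "loewner (b *\<^sub>R id_blinfun) ((b / a) *\<^sub>R Y)"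
    using loewner_scaleR[of "a *\<^sub>R id_blinfun" Y "b / a"] Y ab by (simp add: op_interval_def)
  finally show ?thesis .
qed

lemma posinv_loewner_scaleR:
  assumes "posinv A" "posinv B"
  obtains c where "0 < c" "loewner A (c *\<^sub>R B)"
proof -
  obtain a b where ab: "0 < a" "a \<le> b" and AB: "A \<in> op_interval a b" "B \<in> op_interval a b"
    using posinv_common_interval[OF assms] .
  show thesis by (rule that[OF _ op_interval_ratio[OF AB ab]]) (use ab in simp)
qed

lemma Mop_le: "0 < c \<Longrightarrow> loewner A (c *\<^sub>R B) \<Longrightarrow> Mop A B \<le> c"
  unfolding Mop_def by (rule cInf_lower) (auto intro: bdd_belowI[of _ 0])

lemma Mop_greatest:
  assumes "posinv A" "posinv B" and "\<And>c. 0 < c \<Longrightarrow> loewner A (c *\<^sub>R B) \<Longrightarrow> l \<le> c"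
  shows "l \<le> Mop A B"
  unfolding Mop_def
proof (rule cInf_greatest)
  show "{c. 0 < c \<and> loewner A (c *\<^sub>R B)} \<noteq> {}"
    using posinv_loewner_scaleR[OF assms(1,2)] by blast
qed (use assms(3) in blast)

lemma loewner_Mop:
  assumes A: "posinv A" and B: "posinv B"
  shows "loewner A (Mop A B *\<^sub>R B)"
proof (rule loewnerI)
  fix x
  have form: "A x \<bullet> x \<le> c * (B x \<bullet> x)" if "loewner A (c *\<^sub>R B)" for c
    using loewnerD[OF that, of x] by (simp add: blinfun.bilinear_simps)
  show "A x \<bullet> x \<le> (Mop A B *\<^sub>R B) x \<bullet> x"
  proof (cases "B x \<bullet> x = 0")
    case True
    obtain c where "loewner A (c *\<^sub>R B)" using posinv_loewner_scaleR[OF A B] .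
    from form[OF this] show ?thesis using True by (simp add: blinfun.bilinear_simps)
  next
    case False
    then have pos: "0 < B x \<bullet> x" using positive_opD(2)[OF posinv_positive[OF B], of x] by simp
    then have "(A x \<bullet> x) / (B x \<bullet> x) \<le> Mop A B"
      by (intro Mop_greatest[OF A B]) (simp add: form pos_divide_le_eq)
    then show ?thesis using pos by (simp add: blinfun.bilinear_simps pos_divide_le_eq)
  qed
qed (use A B in \<open>simp_all add: posinv_self_adjoint\<close>)

lemma thompson_commute: "thompson A B = thompson B A"
  by (simp add: thompson_def max.commute)

lemma loewner_thompson:
  assumes A: "posinv A" and B: "posinv B"
  shows "loewner A (exp (thompson A B) *\<^sub>R B)"
proof -
  have "0 \<le> Mop A B" by (rule Mop_greatest[OF A B]) simp
  then have "Mop A B \<le> exp (ln (Mop A B))" by (cases "Mop A B = 0") simp_all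
  also have "\<dots> \<le> exp (thompson A B)" by (simp add: thompson_def)
  finally have "loewner (Mop A B *\<^sub>R B) (exp (thompson A B) *\<^sub>R B)"
    by (rule loewner_scaleR_mono[OF posinv_positive[OF B]])
  then show ?thesis using loewner_trans[OF loewner_Mop[OF A B]] by blast
qed

lemma thompson_leI:
  assumes "posinv A" "posinv B" "0 \<le> \<delta>" "loewner A (exp \<delta> *\<^sub>R B)" "loewner B (exp \<delta> *\<^sub>R A)"
  shows "thompson A B \<le> \<delta>"
proof -
  have "ln (Mop P Q) \<le> \<delta>" if "posinv P" "posinv Q" "loewner P (exp \<delta> *\<^sub>R Q)" for P Q :: "'a op"
  proof (cases "Mop P Q = 0")
    case False
    moreover have "0 \<le> Mop P Q" by (rule Mop_greatest[OF that(1,2)]) simp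
    moreover have "Mop P Q \<le> exp \<delta>" by (rule Mop_le[OF _ that(3)]) simp
    ultimately show ?thesis using ln_le_cancel_iff[of "Mop P Q" "exp \<delta>"] by simp
  qed (use \<open>0 \<le> \<delta>\<close> in simp)
  then show ?thesis using assms unfolding thompson_def by simp
qed

lemma thompson_triangle_loewner:
  assumes "posinv A" "posinv B" "posinv C"
  shows "loewner A (exp (thompson A B + thompson B C) *\<^sub>R C)"
proof -
  have "loewner A (exp (thompson A B) *\<^sub>R B)" by (intro loewner_thompson assms)
  also have "loewner (exp (thompson A B) *\<^sub>R B) (exp (thompson A B) *\<^sub>R (exp (thompson B C) *\<^sub>R C))"
    by (intro loewner_scaleR loewner_thompson assms) simp
  finally show ?thesis by (simp add: exp_add)
qed

text \<open>On the zero space \<^const>\<open>Mop\<close> is \<open>0\<close> and the claim rests on \<open>ln 0 = 0\<close>.\<close>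

lemma thompson_nonneg:
  fixes A B :: "'a::{real_inner,complete_space} op"
  assumes A: "posinv A" and B: "posinv B"
  shows "0 \<le> thompson A B"
proof (cases "\<exists>x::'a. x \<noteq> 0")
  case True
  then obtain x :: 'a where "x \<noteq> 0" by blast
  obtain a b where a: "0 < a" "A \<in> op_interval a b" using posinv_op_interval[OF A] .
  have "0 < a * (norm x)\<^sup>2" using a \<open>x \<noteq> 0\<close> by simp
  also have "\<dots> \<le> A x \<bullet> x" using a by (simp add: op_interval_iff)
  finally have "0 < A x \<bullet> x" .
  moreover have "1 * (A x \<bullet> x) \<le> exp (2 * thompson A B) * (A x \<bullet> x)"
    using loewnerD[OF thompson_triangle_loewner[OF A B A], of x]
    by (simp add: blinfun.bilinear_simps thompson_commute[of B A])
  ultimately have "1 \<le> exp (2 * thompson A B)" by (simp add: mult_le_cancel_right)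
  then show ?thesis by simp
next
  case False
  then have trivial: "x = 0" for x :: 'a by blast
  have "loewner C D" for C D :: "'a op"
    unfolding loewner_iff self_adjoint_def
    by (metis inner_zero_left inner_zero_right order_refl trivial)
  then have "Mop C D = 0" for C D :: "'a op"
    by (simp add: Mop_def greaterThan_def[symmetric])
  then show ?thesis by (simp add: thompson_def)
qed

lemma thompson_triangle:
  assumes A: "posinv A" and B: "posinv B" and C: "posinv C"
  shows "thompson A C \<le> thompson A B + thompson B C"
proof (rule thompson_leI[OF A C])
  show "loewner C (exp (thompson A B + thompson B C) *\<^sub>R A)"
    using thompson_triangle_loewner[OF C B A] by (simp add: thompson_commute add.commute)
qed (use assms in \<open>simp_all add: thompson_triangle_loewner thompson_nonneg\<close>)

lemma norm_diff_le_of_loewner: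
  assumes "self_adjoint A" "self_adjoint B" "0 \<le> e"
    and AB_close: "loewner A (B + e *\<^sub>R id_blinfun)" "loewner B (A + e *\<^sub>R id_blinfun)"
  shows "norm (A - B) \<le> e"
proof (rule norm_self_adjoint_le)
  show "\<bar>(A - B) x \<bullet> x\<bar> \<le> e * (norm x)\<^sup>2" for x
    using AB_close[THEN loewnerD, of x] by (simp add: inner_blinfun_simps)
qed (use assms in simp_all)

lemma loewner_add_norm_diff:
  assumes "self_adjoint A" "self_adjoint B"
  shows "loewner A (B + norm (A - B) *\<^sub>R id_blinfun)"
proof (rule loewnerI)
  show "A x \<bullet> x \<le> (B + norm (A - B) *\<^sub>R id_blinfun) x \<bullet> x" for x
    using inner_blinfun_le_norm[of "A - B" x] by (simp add: inner_blinfun_simps)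
qed (use assms in simp_all)

lemma add_scaleR_id_loewner_exp:
  assumes B: "B \<in> op_interval a b" and a_pos: "0 < a" and "0 \<le> e"
  shows "loewner (B + e *\<^sub>R id_blinfun) (exp (e / a) *\<^sub>R B)"
proof -
  have "loewner ((e / a) *\<^sub>R (a *\<^sub>R id_blinfun)) ((e / a) *\<^sub>R B)"
    using B a_pos \<open>0 \<le> e\<close> by (intro loewner_scaleR) (simp_all add: op_interval_def)
  then have "loewner (B + e *\<^sub>R id_blinfun) (B + (e / a) *\<^sub>R B)"
    using a_pos by (intro loewner_add) simp_all
  also have "B + (e / a) *\<^sub>R B = (1 + e / a) *\<^sub>R B" by (simp add: scaleR_add_left)
  also have "loewner ((1 + e / a) *\<^sub>R B) (exp (e / a) *\<^sub>R B)"
    by (intro loewner_scaleR_mono posinv_positive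
      op_interval_posinv[OF B a_pos] exp_ge_add_one_self)
  finally show ?thesis .
qed

lemma thompson_le_norm:
  assumes A: "A \<in> op_interval a b" and B: "B \<in> op_interval a b" and a_pos: "0 < a"
  shows "thompson A B \<le> (1 / a) * norm (A - B)"
proof -
  have "loewner P (exp (norm (P - Q) / a) *\<^sub>R Q)"
    if "P \<in> op_interval a b" "Q \<in> op_interval a b" for P Q :: "'a op"
    using loewner_add_norm_diff[OF that[THEN op_interval_self_adjoint]]
      add_scaleR_id_loewner_exp[OF that(2) a_pos norm_ge_zero] by (rule loewner_trans)
  from this[OF A B] this[OF B A] have "thompson A B \<le> norm (A - B) / a"
    using a_pos by (intro thompson_leI op_interval_posinv[OF A] op_interval_posinv[OF B])
      (simp_all add: norm_minus_commute)
  then show ?thesis by simp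
qed

lemma loewner_exp_imp_add_scaleR_id:
  assumes "loewner A (exp \<delta> *\<^sub>R B)" "loewner B (b *\<^sub>R id_blinfun)" "0 \<le> \<delta>"
  shows "loewner A (B + ((exp \<delta> - 1) * b) *\<^sub>R id_blinfun)"
proof -
  have "exp \<delta> *\<^sub>R B = B + (exp \<delta> - 1) *\<^sub>R B" by (simp add: scaleR_diff_left)
  with assms(1) have "loewner A (B + (exp \<delta> - 1) *\<^sub>R B)" by simp
  also have "loewner (B + (exp \<delta> - 1) *\<^sub>R B) (B + (exp \<delta> - 1) *\<^sub>R (b *\<^sub>R id_blinfun))"
    using assms(2,3) by (intro loewner_add loewner_scaleR) simp_all
  finally show ?thesis by simp
qed

lemma norm_le_thompson:
  assumes A: "A \<in> op_interval a b" and B: "B \<in> op_interval a b" and ab: "0 < a" "a \<le> b"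
  shows "norm (A - B) \<le> (b\<^sup>2 / a) * thompson A B"
proof -
  note pos = op_interval_posinv[OF A ab(1)] op_interval_posinv[OF B ab(1)]
  define \<delta> where "\<delta> = thompson A B"
  have "0 \<le> \<delta>" unfolding \<delta>_def by (rule thompson_nonneg[OF pos])
  have "\<delta> \<le> ln (b / a)"
    unfolding \<delta>_def using ab A B by (intro thompson_leI[OF pos]) (simp_all add: op_interval_ratio)
  then have "exp \<delta> \<le> b / a" using ab
    by (metis exp_le_cancel_iff exp_ln divide_pos_pos less_le_trans)
  have "exp \<delta> * (1 + - \<delta>) \<le> exp \<delta> * exp (- \<delta>)" by (intro mult_left_mono exp_ge_add_one_self) simp
  then have "exp \<delta> - 1 \<le> \<delta> * exp \<delta>" by (simp add: exp_minus algebra_simps)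
  also have "\<dots> \<le> \<delta> * (b / a)" using \<open>exp \<delta> \<le> b / a\<close> \<open>0 \<le> \<delta>\<close> by (rule mult_left_mono)
  finally have exp_bound: "exp \<delta> - 1 \<le> \<delta> * (b / a)" .
  have "norm (A - B) \<le> (exp \<delta> - 1) * b"
  proof (rule norm_diff_le_of_loewner)
    show "loewner A (B + ((exp \<delta> - 1) * b) *\<^sub>R id_blinfun)"
      using loewner_thompson[OF pos] B \<open>0 \<le> \<delta>\<close>
      by (intro loewner_exp_imp_add_scaleR_id) (simp_all add: \<delta>_def op_interval_def)
    show "loewner B (A + ((exp \<delta> - 1) * b) *\<^sub>R id_blinfun)"
      using loewner_thompson[OF pos(2,1)] A \<open>0 \<le> \<delta>\<close>
      by (intro loewner_exp_imp_add_scaleR_id)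
        (simp_all add: \<delta>_def op_interval_def thompson_commute)
  qed (use A B ab \<open>0 \<le> \<delta>\<close> in \<open>simp_all add: op_interval_self_adjoint\<close>)
  also have "\<dots> \<le> \<delta> * (b / a) * b" using exp_bound ab by (intro mult_right_mono) simp_all
  also have "\<dots> = (b\<^sup>2 / a) * \<delta>" by (simp add: power2_eq_square)
  finally show ?thesis by (simp add: \<delta>_def)
qed

lemma thompson_sharp_le:
  assumes pos: "posinv A" "posinv B" "posinv C" "posinv D" and t_range: "0 \<le> t" "t \<le> 1"
  shows "thompson (sharp t A B) (sharp t C D) \<le> (1 - t) * thompson A C + t * thompson B D"
proof -
  have sharp_le: "loewner (sharp t P Q)
      (exp ((1 - t) * thompson P R + t * thompson Q S) *\<^sub>R sharp t R S)"
    if "posinv P" "posinv Q" "posinv R" "posinv S" for P Q R S :: "'a op"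
  proof -
    have "loewner (sharp t P Q) (sharp t (exp (thompson P R) *\<^sub>R R) (exp (thompson Q S) *\<^sub>R S))"
      by (intro sharp_mono posinv_scaleR loewner_thompson that t_range) simp_all
    then show ?thesis
      by (simp add: sharp_scaleR that exp_powr_real exp_add mult.commute)
  qed
  show ?thesis
    using sharp_le[OF pos(3,4,1,2)] t_range thompson_nonneg[OF pos(1,3)]
      thompson_nonneg[OF pos(2,4)]
    by (intro thompson_leI posinv_sharp pos sharp_le) (simp_all add: thompson_commute)
qed

subsection \<open>Leave-one-out iteration in a metric space\<close>

lemma length_drop_nth: "i < length xs \<Longrightarrow> length (drop_nth i xs) = length xs - 1"
  by (simp add: drop_nth_def)

lemma nth_drop_nth:
  assumes "i < length xs" "j < length xs - 1"
  shows "drop_nth i xs ! j = (if j < i then xs ! j else xs ! Suc j)"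
  using assms by (auto simp: drop_nth_def nth_append min_def)

lemma drop_nth_in_nlists: "xs \<in> nlists (Suc n) S \<Longrightarrow> i \<le> n \<Longrightarrow> drop_nth i xs \<in> nlists n S"
  unfolding nlists_def drop_nth_def by (auto dest: in_set_takeD in_set_dropD)

lemma drop_nth_replicate: "i \<le> n \<Longrightarrow> drop_nth i (replicate (Suc n) x) = replicate n x"
  by (rule nth_equalityI) (auto simp: length_drop_nth nth_drop_nth simp del: replicate_Suc)

lemma drop_nth_Suc: "Suc i < length xs \<Longrightarrow> drop_nth (Suc i) xs = (drop_nth i xs)[i := xs ! i]"
  by (rule nth_equalityI) (auto simp: length_drop_nth nth_drop_nth nth_list_update)

lemma drop_nth_update_same: "i < length xs \<Longrightarrow> drop_nth i (xs[i := x]) = drop_nth i xs"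
  by (rule nth_equalityI) (auto simp: length_drop_nth nth_drop_nth)

lemma drop_nth_update_other:
  assumes "i < length xs" "j < length xs" "i \<noteq> j"
  obtains l where "l < length xs - 1" "drop_nth i xs ! l = xs ! j"
    "drop_nth i (xs[j := x]) = (drop_nth i xs)[l := x]"
proof
  let ?l = "if j < i then j else j - 1"
  show "?l < length xs - 1" "drop_nth i xs ! ?l = xs ! j"
    using assms by (auto simp: nth_drop_nth)
  show "drop_nth i (xs[j := x]) = (drop_nth i xs)[?l := x]"
    using assms by (intro nth_equalityI) (auto simp: length_drop_nth nth_drop_nth nth_list_update)
qed

definition leave_one_out :: "('a list \<Rightarrow> 'a) \<Rightarrow> 'a list \<Rightarrow> 'a list" where
  "leave_one_out f xs = map (\<lambda>i. f (drop_nth i xs)) [0..<length xs]"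

lemma nth_leave_one_out: "i < length xs \<Longrightarrow> leave_one_out f xs ! i = f (drop_nth i xs)"
  by (simp add: leave_one_out_def)

context Metric_space
begin

lemma dist_le_sum_steps:
  assumes "i \<le> j" and "\<And>k. i \<le> k \<Longrightarrow> k \<le> j \<Longrightarrow> x k \<in> M"
  shows "d (x i) (x j) \<le> (\<Sum>k = i..<j. d (x k) (x (Suc k)))"
  using assms
proof (induction j rule: dec_induct)
  case (step j)
  have "d (x i) (x (Suc j)) \<le> d (x i) (x j) + d (x j) (x (Suc j))"
    using step by (intro triangle) simp_all
  then show ?case using step by simp
qed simp

lemma MCauchy_of_summable_steps:
  assumes x_in: "range x \<subseteq> M" and step: "\<And>k. d (x k) (x (Suc k)) \<le> e k" and "summable e"
  shows "MCauchy x"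
  unfolding MCauchy_def
proof (intro conjI allI impI x_in)
  fix \<epsilon> :: real assume "0 < \<epsilon>"
  then obtain N where N: "norm (sum e {m..<n}) < \<epsilon>" if "m \<ge> N" for m n
    using \<open>summable e\<close> unfolding summable_Cauchy by meson
  have close: "d (x m) (x n) < \<epsilon>" if "m \<ge> N" "m \<le> n" for m n
  proof -
    have "d (x m) (x n) \<le> (\<Sum>k = m..<n. d (x k) (x (Suc k)))"
      using x_in by (intro dist_le_sum_steps that(2)) auto
    also have "\<dots> \<le> sum e {m..<n}" by (intro sum_mono step)
    also have "\<dots> < \<epsilon>" using N[OF that(1), of n] by simp
    finally show ?thesis .
  qed
  show "\<exists>N. \<forall>m n. N \<le> m \<longrightarrow> N \<le> n \<longrightarrow> d (x m) (x n) < \<epsilon>"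
    using close commute by (metis nle_le)
qed

lemma dist_limit_le:
  assumes x_lim: "limitin mtopology x l sequentially"
    and y_lim: "limitin mtopology y l' sequentially"
    and xy_close: "\<forall>\<^sub>F n in sequentially. d (x n) (y n) \<le> \<delta>"
  shows "d l l' \<le> \<delta>"
proof -
  note dist_null = x_lim[unfolded limitin_metric_dist_null] y_lim[unfolded limitin_metric_dist_null]
  have "(\<lambda>n. d (x n) l + \<delta> + d (y n) l') \<longlonglongrightarrow> 0 + \<delta> + 0" using dist_null by (intro tendsto_intros) auto
  moreover have "\<forall>\<^sub>F n in sequentially. d l l' \<le> d (x n) l + \<delta> + d (y n) l'"
    using xy_close dist_null(1)[THEN conjunct2, THEN conjunct1]
      dist_null(2)[THEN conjunct2, THEN conjunct1]
  proof eventually_elim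
    case (elim n)
    have "d l l' \<le> d (x n) l + d (x n) l'" using elim dist_null by (intro triangle'') auto
    also have "d (x n) l' \<le> d (x n) (y n) + d (y n) l'" using elim dist_null
      by (intro triangle) auto
    finally show ?case using elim by simp
  qed
  ultimately show ?thesis using tendsto_lowerbound[of _ "0 + \<delta> + 0" sequentially "d l l'"] by simp
qed

end

locale contractive_mean = Metric_space M d for M :: "'a set" and d +
  fixes \<rho> :: real and n :: nat and f :: "'a list \<Rightarrow> 'a"
  assumes rate: "0 \<le> \<rho>" "\<rho> < 1"
    and mean_in: "As \<in> nlists n M \<Longrightarrow> f As \<in> M"
    and mean_replicate: "A \<in> M \<Longrightarrow> f (replicate n A) = A"
    and mean_nonexpansive: "As \<in> nlists n M \<Longrightarrow> Bs \<in> nlists n M \<Longrightarrow>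
      (\<And>i. i < n \<Longrightarrow> d (As ! i) (Bs ! i) \<le> \<delta>) \<Longrightarrow> d (f As) (f Bs) \<le> \<delta>"
    and mean_contraction: "As \<in> nlists n M \<Longrightarrow> j < n \<Longrightarrow> B \<in> M \<Longrightarrow>
      d (f As) (f (As[j := B])) \<le> \<rho> * d (As ! j) B"
begin

abbreviation iterate :: "nat \<Rightarrow> 'a list \<Rightarrow> 'a list" where
  "iterate r \<equiv> leave_one_out f ^^ r"

lemma leave_one_out_in: "As \<in> nlists (Suc n) M \<Longrightarrow> leave_one_out f As \<in> nlists (Suc n) M"
  by (rule nlistsI) (auto simp: leave_one_out_def intro!: mean_in drop_nth_in_nlists)

lemma iterate_in: "As \<in> nlists (Suc n) M \<Longrightarrow> iterate r As \<in> nlists (Suc n) M"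
  by (induction r) (simp_all add: leave_one_out_in)

lemma iterate_nth_in: "As \<in> nlists (Suc n) M \<Longrightarrow> i \<le> n \<Longrightarrow> iterate r As ! i \<in> M"
  using nlistsE_nth_in[OF iterate_in] by simp

lemma iterate_nth_Suc:
  "As \<in> nlists (Suc n) M \<Longrightarrow> i \<le> n \<Longrightarrow> iterate (Suc r) As ! i = f (drop_nth i (iterate r As))"
  using nlistsE_length[OF iterate_in, of As r] by (simp add: nth_leave_one_out)

text \<open>The lists omitting entry \<open>i\<close> and entry \<open>i + 1\<close> differ in position \<open>i\<close> only.\<close>

lemma iterate_neighbours_contract:
  assumes As: "As \<in> nlists (Suc n) M" and i_less: "i < n"
  shows "d (iterate r As ! i) (iterate r As ! Suc i) \<le> \<rho> ^ r * d (As ! i) (As ! Suc i)"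
proof (induction r)
  case (Suc r)
  let ?Bs = "iterate r As"
  have Bs: "?Bs \<in> nlists (Suc n) M" by (rule iterate_in[OF As])
  have "d (iterate (Suc r) As ! i) (iterate (Suc r) As ! Suc i)
      = d (f (drop_nth i ?Bs)) (f ((drop_nth i ?Bs)[i := ?Bs ! i]))"
    using iterate_nth_Suc[OF As, of i r] iterate_nth_Suc[OF As, of "Suc i" r] i_less Bs
    by (simp add: drop_nth_Suc del: funpow.simps)
  also have "\<dots> \<le> \<rho> * d (drop_nth i ?Bs ! i) (?Bs ! i)"
    using i_less
    by (intro mean_contraction drop_nth_in_nlists[OF Bs] nlistsE_nth_in[OF Bs]) simp_all
  also have "\<dots> = \<rho> * d (?Bs ! i) (?Bs ! Suc i)"
    using i_less Bs by (simp add: nth_drop_nth commute)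
  also have "\<dots> \<le> \<rho> * (\<rho> ^ r * d (As ! i) (As ! Suc i))" by (intro mult_left_mono Suc rate)
  finally show ?case by simp
qed simp

lemma iterate_diameter:
  assumes As: "As \<in> nlists (Suc n) M" and "i \<le> n" "j \<le> n"
  shows "d (iterate r As ! i) (iterate r As ! j) \<le> (\<Sum>k<n. d (As ! k) (As ! Suc k)) * \<rho> ^ r"
  using assms(2,3)
proof (induction i j rule: linorder_wlog)
  case (le i j)
  have "d (iterate r As ! i) (iterate r As ! j)
      \<le> (\<Sum>k = i..<j. d (iterate r As ! k) (iterate r As ! Suc k))"
    using le by (intro dist_le_sum_steps iterate_nth_in[OF As]) simp_all
  also have "\<dots> \<le> (\<Sum>k = i..<j. \<rho> ^ r * d (As ! k) (As ! Suc k))"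
    using le by (intro sum_mono iterate_neighbours_contract[OF As]) simp
  also have "\<dots> \<le> (\<Sum>k<n. \<rho> ^ r * d (As ! k) (As ! Suc k))"
    using le rate by (intro sum_mono2) auto
  finally show ?case by (simp add: sum_distrib_left[symmetric] mult.commute)
next
  case (sym i j)
  then show ?case by (simp add: commute)
qed

lemma iterate_step:
  assumes As: "As \<in> nlists (Suc n) M" and i_le: "i \<le> n"
  shows "d (iterate r As ! i) (iterate (Suc r) As ! i) \<le> (\<Sum>k<n. d (As ! k) (As ! Suc k)) * \<rho> ^ r"
proof -
  let ?Bs = "iterate r As"
  have Bs: "?Bs \<in> nlists (Suc n) M" by (rule iterate_in[OF As])
  have "d (f (replicate n (?Bs ! i))) (f (drop_nth i ?Bs))
      \<le> (\<Sum>k<n. d (As ! k) (As ! Suc k)) * \<rho> ^ r"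
  proof (rule mean_nonexpansive)
    show "replicate n (?Bs ! i) \<in> nlists n M" "drop_nth i ?Bs \<in> nlists n M"
      using i_le by (auto intro!: nlists_replicateI drop_nth_in_nlists[OF Bs] nlistsE_nth_in[OF Bs])
    show "d (replicate n (?Bs ! i) ! k) (drop_nth i ?Bs ! k)
        \<le> (\<Sum>k<n. d (As ! k) (As ! Suc k)) * \<rho> ^ r" if "k < n" for k
      using that i_le Bs iterate_diameter[OF As i_le, of k r]
        iterate_diameter[OF As i_le, of "Suc k" r]
      by (simp add: nth_drop_nth)
  qed
  then show ?thesis
    using iterate_nth_Suc[OF As i_le, of r] mean_replicate[OF iterate_nth_in[OF As i_le]]
    by (simp del: funpow.simps)
qed

lemma iterate_common_limit:
  assumes mcomplete and As: "As \<in> nlists (Suc n) M"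
  obtains L where "\<And>i. i \<le> n \<Longrightarrow> limitin mtopology (\<lambda>r. iterate r As ! i) L sequentially"
proof -
  define D where "D = (\<Sum>k<n. d (As ! k) (As ! Suc k))"
  have "MCauchy (\<lambda>r. iterate r As ! 0)"
  proof (rule MCauchy_of_summable_steps)
    show "range (\<lambda>r. iterate r As ! 0) \<subseteq> M" using iterate_nth_in[OF As] by auto
    show "summable (\<lambda>r. D * \<rho> ^ r)" using rate by (intro summable_mult summable_geometric) simp
    show "d (iterate r As ! 0) (iterate (Suc r) As ! 0) \<le> D * \<rho> ^ r" for r
      unfolding D_def by (rule iterate_step[OF As]) simp
  qed
  then obtain L where "limitin mtopology (\<lambda>r. iterate r As ! 0) L sequentially"
    using \<open>mcomplete\<close> unfolding mcomplete_def by blast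
  then have L: "L \<in> M" "(\<lambda>r. d (iterate r As ! 0) L) \<longlonglongrightarrow> 0"
    by (simp_all add: limitin_metric_dist_null)
  have "limitin mtopology (\<lambda>r. iterate r As ! i) L sequentially" if i_le: "i \<le> n" for i
    unfolding limitin_metric_dist_null
  proof (intro conjI L(1) always_eventually allI iterate_nth_in[OF As i_le])
    have "(\<lambda>r. D * \<rho> ^ r + d (iterate r As ! 0) L) \<longlonglongrightarrow> D * 0 + 0"
      using rate by (intro tendsto_intros L(2) LIMSEQ_realpow_zero)
    then have bound_lim: "(\<lambda>r. D * \<rho> ^ r + d (iterate r As ! 0) L) \<longlonglongrightarrow> 0" by simp
    have bound: "d (iterate r As ! i) L \<le> D * \<rho> ^ r + d (iterate r As ! 0) L" for r
      using triangle[of "iterate r As ! i" "iterate r As ! 0" L] iterate_nth_in[OF As] i_le L(1)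
        iterate_diameter[OF As i_le, of 0 r] by (force simp: D_def)
    show "(\<lambda>r. d (iterate r As ! i) L) \<longlonglongrightarrow> 0"
      by (rule Lim_null_comparison[OF _ bound_lim]) (simp add: bound)
  qed
  then show thesis by (rule that)
qed

lemma iterate_nonexpansive:
  assumes As: "As \<in> nlists (Suc n) M" and Bs: "Bs \<in> nlists (Suc n) M"
    and AB_close: "\<And>i. i \<le> n \<Longrightarrow> d (As ! i) (Bs ! i) \<le> \<delta>" and "i \<le> n"
  shows "d (iterate r As ! i) (iterate r Bs ! i) \<le> \<delta>"
  using \<open>i \<le> n\<close>
proof (induction r arbitrary: i)
  case (Suc r)
  have in_M: "iterate r As \<in> nlists (Suc n) M" "iterate r Bs \<in> nlists (Suc n) M"
    by (rule iterate_in[OF As], rule iterate_in[OF Bs])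
  have "d (f (drop_nth i (iterate r As))) (f (drop_nth i (iterate r Bs))) \<le> \<delta>"
  proof (rule mean_nonexpansive)
    show "d (drop_nth i (iterate r As) ! k) (drop_nth i (iterate r Bs) ! k) \<le> \<delta>" if "k < n" for k
      using that Suc.prems Suc.IH[of k] Suc.IH[of "Suc k"] in_M by (simp add: nth_drop_nth)
  qed (intro drop_nth_in_nlists in_M Suc.prems)+
  then show ?case using Suc.prems As Bs by (simp only: iterate_nth_Suc)
qed (simp add: AB_close)

lemma leave_one_out_contraction:
  assumes As: "As \<in> nlists (Suc n) M" and i_le: "i \<le> n" and j_le: "j \<le> n" and B: "B \<in> M"
  shows "d (leave_one_out f As ! i) (leave_one_out f (As[j := B]) ! i) \<le> \<rho> * d (As ! j) B"
proof (cases "i = j")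
  case True
  then show ?thesis
    using As i_le B rate
    by (simp add: nth_leave_one_out drop_nth_update_same mean_in drop_nth_in_nlists)
next
  case False
  then obtain l where "l < n" "drop_nth i As ! l = As ! j"
    "drop_nth i (As[j := B]) = (drop_nth i As)[l := B]"
    using drop_nth_update_other[of i As j B] As i_le j_le by auto
  then show ?thesis
    using mean_contraction[OF drop_nth_in_nlists[OF As i_le] \<open>l < n\<close> B] As i_le
    by (simp add: nth_leave_one_out)
qed

lemma iterate_replicate: "A \<in> M \<Longrightarrow> iterate r (replicate (Suc n) A) = replicate (Suc n) A"
proof (induction r)
  case (Suc r)
  have "leave_one_out f (replicate (Suc n) A) = replicate (Suc n) A"
    using Suc.prems by (intro nth_equalityI)
      (auto simp: leave_one_out_def drop_nth_replicate mean_replicate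
        simp del: replicate_Suc upt_Suc)
  then show ?case using Suc by simp
qed simp

theorem contractive_mean_limit:
  assumes lim: "\<And>As i. As \<in> nlists (Suc n) M \<Longrightarrow> i \<le> n \<Longrightarrow>
    limitin mtopology (\<lambda>r. iterate r As ! i) (g As) sequentially"
  shows "contractive_mean M d \<rho> (Suc n) g"
proof
  show "g As \<in> M" if "As \<in> nlists (Suc n) M" for As
    using lim[OF that, of 0] by (simp add: limitin_metric_dist_null)
  show "g (replicate (Suc n) A) = A" if A: "A \<in> M" for A
  proof (rule limitin_metric_unique[OF lim[of _ 0]])
    show "limitin mtopology (\<lambda>r. iterate r (replicate (Suc n) A) ! 0) A sequentially"
      using A by (simp add: iterate_replicate limitin_metric_dist_null del: replicate_Suc)
  qed (use A in \<open>auto intro: nlists_replicateI\<close>)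
  fix As assume As: "As \<in> nlists (Suc n) M"
  show "d (g As) (g Bs) \<le> \<delta>"
    if Bs: "Bs \<in> nlists (Suc n) M" and AB_close: "\<And>i. i < Suc n \<Longrightarrow> d (As ! i) (Bs ! i) \<le> \<delta>" for Bs \<delta>
    using AB_close
    by (intro dist_limit_le[OF lim[OF As, of 0] lim[OF Bs, of 0]] always_eventually allI
        iterate_nonexpansive As Bs) simp_all
  fix j B assume j_less: "j < Suc n" and B: "B \<in> M"
  have As': "As[j := B] \<in> nlists (Suc n) M" using As B by simp
  have "d (iterate (Suc r) As ! 0) (iterate (Suc r) (As[j := B]) ! 0) \<le> \<rho> * d (As ! j) B" for r
    unfolding funpow_Suc_right o_apply
    using j_less B
    by (intro iterate_nonexpansive leave_one_out_in As As' leave_one_out_contraction) simp_all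
  then have "\<forall>\<^sub>F r in sequentially. d (iterate r As ! 0) (iterate r (As[j := B]) ! 0)
      \<le> \<rho> * d (As ! j) B"
    by (intro eventually_sequentiallyI[of 1]) (metis Suc_le_D One_nat_def)
  then show "d (g As) (g (As[j := B])) \<le> \<rho> * d (As ! j) B"
    by (rule dist_limit_le[OF lim[OF As, of 0] lim[OF As', of 0], simplified])
qed (rule rate)+

end

lemma (in Metric_space) contractive_mean_two:
  assumes t_range: "0 < t" "t < 1"
    and closed: "\<And>A B. A \<in> M \<Longrightarrow> B \<in> M \<Longrightarrow> b A B \<in> M" and idem: "\<And>A. A \<in> M \<Longrightarrow> b A A = A"
    and convex: "\<And>A B C D. A \<in> M \<Longrightarrow> B \<in> M \<Longrightarrow> C \<in> M \<Longrightarrow> D \<in> M \<Longrightarrow>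
      d (b A B) (b C D) \<le> (1 - t) * d A C + t * d B D"
  shows "contractive_mean M d (max t (1 - t)) 2 (\<lambda>As. b (As ! 0) (As ! 1))"
proof
  fix As assume As: "As \<in> nlists 2 M"
  then have A: "As ! 0 \<in> M" "As ! 1 \<in> M" by (auto intro: nlistsE_nth_in)
  then show "b (As ! 0) (As ! 1) \<in> M" by (rule closed)
  show "d (b (As ! 0) (As ! 1)) (b (Bs ! 0) (Bs ! 1)) \<le> \<delta>"
    if "Bs \<in> nlists 2 M" and AB_close: "\<And>i. i < 2 \<Longrightarrow> d (As ! i) (Bs ! i) \<le> \<delta>" for Bs \<delta>
  proof -
    have B: "Bs ! 0 \<in> M" "Bs ! 1 \<in> M" using that(1) by (auto intro: nlistsE_nth_in)
    have "(1 - t) * d (As ! 0) (Bs ! 0) + t * d (As ! 1) (Bs ! 1) \<le> (1 - t) * \<delta> + t * \<delta>"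
      using AB_close t_range by (intro add_mono mult_left_mono) simp_all
    then show ?thesis using convex[OF A B] by (simp add: algebra_simps)
  qed
  fix j B assume "j < (2::nat)" and B: "B \<in> M"
  then consider "j = 0" | "j = 1" by linarith
  then show "d (b (As ! 0) (As ! 1)) (b (As[j := B] ! 0) (As[j := B] ! 1))
      \<le> max t (1 - t) * d (As ! j) B"
  proof cases
    case 1
    then have "d (b (As ! 0) (As ! 1)) (b (As[j := B] ! 0) (As[j := B] ! 1))
        \<le> (1 - t) * d (As ! j) B"
      using convex[OF A B A(2)] A As by simp
    also have "\<dots> \<le> max t (1 - t) * d (As ! j) B" by (intro mult_right_mono) simp_all
    finally show ?thesis .
  next
    case 2
    then have "d (b (As ! 0) (As ! 1)) (b (As[j := B] ! 0) (As[j := B] ! 1)) \<le> t * d (As ! j) B"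
      using convex[OF A A(1) B] A As by simp
    also have "\<dots> \<le> max t (1 - t) * d (As ! j) B" by (intro mult_right_mono) simp_all
    finally show ?thesis .
  qed
next
  show "b (replicate 2 A ! 0) (replicate 2 A ! 1) = A" if "A \<in> M" for A
    using that by (simp add: idem)
qed (use t_range in auto)

locale dist_equivalent_metric = Metric_space M d for M :: "'a::metric_space set" and d +
  fixes K :: real
  assumes K_pos: "0 < K"
    and dist_le: "A \<in> M \<Longrightarrow> B \<in> M \<Longrightarrow> dist A B \<le> K * d A B"
    and le_dist: "A \<in> M \<Longrightarrow> B \<in> M \<Longrightarrow> d A B \<le> K * dist A B"
begin

lemma limitin_iff_LIMSEQ:
  assumes x_in: "\<And>n. x n \<in> M" and l_in: "l \<in> M"
  shows "limitin mtopology x l sequentially \<longleftrightarrow> x \<longlonglongrightarrow> l"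
proof -
  have "(\<lambda>n. d (x n) l) \<longlonglongrightarrow> 0 \<longleftrightarrow> (\<lambda>n. dist (x n) l) \<longlonglongrightarrow> 0"
  proof
    assume "(\<lambda>n. d (x n) l) \<longlonglongrightarrow> 0"
    from tendsto_mult_right_zero[OF this, of K] show "(\<lambda>n. dist (x n) l) \<longlonglongrightarrow> 0"
      by (rule tendsto_sandwich[OF _ _ tendsto_const, rotated 2]) (simp_all add: dist_le x_in l_in)
  next
    assume "(\<lambda>n. dist (x n) l) \<longlonglongrightarrow> 0"
    from tendsto_mult_right_zero[OF this, of K] show "(\<lambda>n. d (x n) l) \<longlonglongrightarrow> 0"
      by (rule tendsto_sandwich[OF _ _ tendsto_const, rotated 2]) (simp_all add: le_dist x_in l_in)
  qed
  then show ?thesis using x_in l_in by (simp add: limitin_metric_dist_null tendsto_dist_iff[of x l])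
qed

lemma mcomplete_of_complete:
  assumes "complete M"
  shows mcomplete
  unfolding mcomplete_def
proof (intro allI impI)
  fix x assume "MCauchy x"
  then have x_in: "x n \<in> M" for n unfolding MCauchy_def by blast
  have "Cauchy x"
    unfolding Cauchy_def
  proof (intro allI impI)
    fix e :: real assume "0 < e"
    then have "0 < e / K" using K_pos by simp
    then obtain N where N: "d (x m) (x n) < e / K" if "m \<ge> N" "n \<ge> N" for m n
      using \<open>MCauchy x\<close> unfolding MCauchy_def by meson
    have "dist (x m) (x n) < e" if "m \<ge> N" "n \<ge> N" for m n
    proof -
      have "dist (x m) (x n) \<le> K * d (x m) (x n)" by (intro dist_le x_in)
      also have "\<dots> < e" using N[OF that] K_pos by (simp add: pos_less_divide_eq mult.commute)
      finally show ?thesis .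
    qed
    then show "\<exists>N. \<forall>m\<ge>N. \<forall>n\<ge>N. dist (x m) (x n) < e" by blast
  qed
  then obtain l where "l \<in> M" "x \<longlonglongrightarrow> l" using assms x_in unfolding complete_def by blast
  then show "\<exists>l. limitin mtopology x l sequentially" using limitin_iff_LIMSEQ[of x, OF x_in]
    by blast
qed

end

subsection \<open>Convergence of the Lawson--Lim recursion\<close>

lemma llrec_Suc_altdef:
  "llrec base t (Suc k) As = (THE L. posinv L \<and>
    (\<forall>i<length As. (\<lambda>r. thompson ((leave_one_out (llrec base t k) ^^ r) As ! i) L) \<longlonglongrightarrow> 0))"
  by (simp add: leave_one_out_def[abs_def])

text \<open>The absolute value only serves to meet the axioms of \<^locale>\<open>Metric_space\<close> off the carrier.\<close>

lemma thompson_dist_equivalent: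
  assumes ab: "0 < a" "a \<le> b"
  shows "dist_equivalent_metric (op_interval a b) (\<lambda>A B. \<bar>thompson A B\<bar>) (max (b\<^sup>2 / a) (1 / a))"
proof
  fix A B C :: "'a op"
  let ?K = "max (b\<^sup>2 / a) (1 / a)"
  note pos = op_interval_posinv[OF _ ab(1)]
  show "0 \<le> \<bar>thompson A B\<bar>" by simp
  show "\<bar>thompson A B\<bar> = \<bar>thompson B A\<bar>" by (simp add: thompson_commute)
  show "0 < ?K" using ab by (simp add: less_max_iff_disj)
  assume A: "A \<in> op_interval a b" and B: "B \<in> op_interval a b"
  have nonneg: "0 \<le> thompson A B" by (rule thompson_nonneg[OF pos[OF A] pos[OF B]])
  have "norm (A - B) \<le> (b\<^sup>2 / a) * thompson A B" by (rule norm_le_thompson[OF A B ab])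
  also have "\<dots> \<le> ?K * thompson A B" by (intro mult_right_mono nonneg) simp
  finally show norm_le: "dist A B \<le> ?K * \<bar>thompson A B\<bar>" using nonneg by (simp add: dist_norm)
  have "thompson A B \<le> (1 / a) * norm (A - B)" by (rule thompson_le_norm[OF A B ab(1)])
  also have "\<dots> \<le> ?K * norm (A - B)" by (intro mult_right_mono) simp_all
  finally show le_norm: "\<bar>thompson A B\<bar> \<le> ?K * dist A B" using nonneg by (simp add: dist_norm)
  show "\<bar>thompson A B\<bar> = 0 \<longleftrightarrow> A = B" using norm_le le_norm by auto
  show "\<bar>thompson A C\<bar> \<le> \<bar>thompson A B\<bar> + \<bar>thompson B C\<bar>" if C: "C \<in> op_interval a b"
    using thompson_triangle[OF pos[OF A] pos[OF B] pos[OF C]]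
      thompson_nonneg[OF pos[OF A] pos[OF C]] by linarith
qed

lemma tendsto_thompson_iff:
  assumes X: "\<And>n. X n \<in> op_interval a b" and a_pos: "0 < a" and L: "posinv L"
  shows "(\<lambda>n. thompson (X n) L) \<longlonglongrightarrow> 0 \<longleftrightarrow> X \<longlonglongrightarrow> L"
proof -
  obtain c d where cd: "0 < c" "c \<le> d" "L \<in> op_interval c d" using posinv_op_interval[OF L] .
  define l u where "l = min a c" and "u = max b d"
  have lu: "0 < l" "l \<le> u" using a_pos cd by (auto simp: l_def u_def)
  have L': "L \<in> op_interval l u" by (rule op_interval_mono[OF cd(3)]) (auto simp: l_def u_def)
  have X': "X n \<in> op_interval l u" for n by (rule op_interval_mono[OF X]) (auto simp: l_def u_def)
  interpret dist_equivalent_metric "op_interval l u :: 'a op set"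
    "\<lambda>A B. \<bar>thompson A B\<bar>" "max (u\<^sup>2 / l) (1 / l)"
    by (rule thompson_dist_equivalent[OF lu])
  show ?thesis
    using limitin_iff_LIMSEQ[of X, OF X' L'] X' L'
    by (simp add: limitin_metric_dist_null tendsto_rabs_zero_iff)
qed

lemma llrec_Suc_eqI:
  assumes iterates: "\<And>r i. i < length As \<Longrightarrow>
      (leave_one_out (llrec base t k) ^^ r) As ! i \<in> op_interval a b"
    and limit: "\<And>i. i < length As \<Longrightarrow> (\<lambda>r. (leave_one_out (llrec base t k) ^^ r) As ! i) \<longlonglongrightarrow> L"
    and "0 < a" "posinv L" "0 < length As"
  shows "llrec base t (Suc k) As = L"
  unfolding llrec_Suc_altdef
proof (rule the_equality)
  have thompson_iff: "(\<lambda>r. thompson ((leave_one_out (llrec base t k) ^^ r) As ! i) P) \<longlonglongrightarrow> 0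
      \<longleftrightarrow> (\<lambda>r. (leave_one_out (llrec base t k) ^^ r) As ! i) \<longlonglongrightarrow> P"
    if "i < length As" "posinv P" for i P
    by (rule tendsto_thompson_iff[OF iterates[OF that(1)] \<open>0 < a\<close> that(2)])
  show "posinv L \<and> (\<forall>i<length As.
        (\<lambda>r. thompson ((leave_one_out (llrec base t k) ^^ r) As ! i) L) \<longlonglongrightarrow> 0)"
    using limit \<open>posinv L\<close> by (simp add: thompson_iff)
  fix L' assume L': "posinv L' \<and>
    (\<forall>i<length As. (\<lambda>r. thompson ((leave_one_out (llrec base t k) ^^ r) As ! i) L') \<longlonglongrightarrow> 0)"
  then have "(\<lambda>r. (leave_one_out (llrec base t k) ^^ r) As ! 0) \<longlonglongrightarrow> L'"
    using thompson_iff[of 0 L'] \<open>0 < length As\<close> by simp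
  then show "L' = L" using limit[OF \<open>0 < length As\<close>] by (rule LIMSEQ_unique)
qed

locale interval_mean = dist_equivalent_metric "op_interval m M :: 'a op set" d K
  for m M :: real and d :: "'a::{real_inner,complete_space} op \<Rightarrow> 'a op \<Rightarrow> real" and K :: real +
  fixes base :: "real \<Rightarrow> 'a op \<Rightarrow> 'a op \<Rightarrow> 'a op" and t \<rho> :: real
  assumes m_pos: "0 < m"
    and base_contractive: "contractive_mean (op_interval m M) d \<rho> 2 (\<lambda>As. base t (As ! 0) (As ! 1))"
begin

abbreviation "iterate k r \<equiv> leave_one_out (llrec base t k) ^^ r"

lemma llrec_Suc_limit:
  assumes "contractive_mean (op_interval m M) d \<rho> n (llrec base t k)"
    and As: "As \<in> nlists (Suc n) (op_interval m M)" and i_le: "i \<le> n"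
  shows "limitin mtopology (\<lambda>r. iterate k r As ! i) (llrec base t (Suc k) As) sequentially"
proof -
  interpret mean: contractive_mean "op_interval m M" d \<rho> n "llrec base t k" by fact
  obtain L where L: "limitin mtopology (\<lambda>r. iterate k r As ! i) L sequentially" if "i \<le> n" for i
    using mean.iterate_common_limit[OF mcomplete_of_complete[OF complete_op_interval] As] by blast
  then have "L \<in> op_interval m M" by (auto simp: limitin_metric_dist_null)
  have "llrec base t (Suc k) As = L"
  proof (rule llrec_Suc_eqI)
    fix i assume i_less: "i < length As"
    then show in_S: "iterate k r As ! i \<in> op_interval m M" for r
      using mean.iterate_nth_in[OF As] As by simp
    show "(\<lambda>r. iterate k r As ! i) \<longlonglongrightarrow> L"
      using L[of i] i_less As
        limitin_iff_LIMSEQ[of "\<lambda>r. iterate k r As ! i", OF in_S \<open>L \<in> op_interval m M\<close>]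
      by simp
  qed (use As m_pos op_interval_posinv[OF \<open>L \<in> op_interval m M\<close>] in auto)
  then show ?thesis using L[OF i_le] by simp
qed

theorem llrec_contractive_mean: "contractive_mean (op_interval m M) d \<rho> (k + 2) (llrec base t k)"
proof (induction k)
  case 0
  show ?case using base_contractive by (simp add: numeral_2_eq_2)
next
  case (Suc k)
  then have "contractive_mean (op_interval m M) d \<rho> (Suc (k + 2)) (llrec base t (Suc k))"
    by (rule contractive_mean.contractive_mean_limit) (rule llrec_Suc_limit[OF Suc])
  then show ?case by simp
qed

lemma llrec_in: "As \<in> nlists (k + 2) (op_interval m M) \<Longrightarrow> llrec base t k As \<in> op_interval m M"
  by (rule contractive_mean.mean_in[OF llrec_contractive_mean])

lemma iterate_in:
  "As \<in> nlists (Suc (k + 2)) (op_interval m M)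
    \<Longrightarrow> iterate k r As \<in> nlists (Suc (k + 2)) (op_interval m M)"
  by (rule contractive_mean.iterate_in[OF llrec_contractive_mean])

lemma iterate_LIMSEQ:
  assumes As: "As \<in> nlists (Suc (k + 2)) (op_interval m M)" and i_le: "i \<le> k + 2"
  shows "(\<lambda>r. iterate k r As ! i) \<longlonglongrightarrow> llrec base t (Suc k) As"
proof -
  have "iterate k r As ! i \<in> op_interval m M" for r
    using nlistsE_nth_in[OF iterate_in[OF As]] i_le by simp
  moreover have "llrec base t (Suc k) As \<in> op_interval m M" using llrec_in[of As "Suc k"] As by simp
  ultimately show ?thesis
    using llrec_Suc_limit[OF llrec_contractive_mean As i_le]
      limitin_iff_LIMSEQ[of "\<lambda>r. iterate k r As ! i" "llrec base t (Suc k) As"] by simp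
qed

end

lemma interval_mean_wam2:
  assumes "0 < m" "0 < t" "t < 1"
  shows "interval_mean m M dist 1 wam2 t (max t (1 - t))"
proof -
  interpret Metric_space "op_interval m M :: 'a op set" dist by (rule Met_TC.subspace) simp
  have "dist_equivalent_metric (op_interval m M :: 'a op set) dist 1" by unfold_locales simp_all
  moreover
  have "contractive_mean (op_interval m M :: 'a op set) dist (max t (1 - t)) 2
      (\<lambda>As. wam2 t (As ! 0) (As ! 1))"
  proof (rule contractive_mean_two)
    fix A B C D :: "'a op"
    have "wam2 t A B - wam2 t C D = (1 - t) *\<^sub>R (A - C) + t *\<^sub>R (B - D)"
      by (simp add: wam2_def algebra_simps)
    then show "dist (wam2 t A B) (wam2 t C D) \<le> (1 - t) * dist A C + t * dist B D"
      using norm_triangle_ineq[of "(1 - t) *\<^sub>R (A - C)" "t *\<^sub>R (B - D)"] assms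
      by (simp add: dist_norm)
  qed (use assms in \<open>simp_all add: wam2_in_op_interval wam2_same\<close>)
  ultimately show ?thesis using assms(1) by (intro interval_mean.intro interval_mean_axioms.intro)
qed

lemma interval_mean_sharp:
  assumes mM: "0 < m" "m \<le> M" and t_range: "0 < t" "t < 1"
  shows "interval_mean m M (\<lambda>A B. \<bar>thompson A B\<bar>) (max (M\<^sup>2 / m) (1 / m)) sharp t (max t (1 - t))"
proof -
  interpret dist_equivalent_metric "op_interval m M :: 'a op set"
    "\<lambda>A B. \<bar>thompson A B\<bar>" "max (M\<^sup>2 / m) (1 / m)"
    by (rule thompson_dist_equivalent[OF mM])
  note pos = op_interval_posinv[OF _ mM(1)]
  have "contractive_mean (op_interval m M :: 'a op set) (\<lambda>A B. \<bar>thompson A B\<bar>) (max t (1 - t)) 2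
      (\<lambda>As. sharp t (As ! 0) (As ! 1))"
  proof (rule contractive_mean_two)
    fix A B C D :: "'a op"
    assume "A \<in> op_interval m M" "B \<in> op_interval m M" "C \<in> op_interval m M" "D \<in> op_interval m M"
    note ABCD = this[THEN pos]
    show "\<bar>thompson (sharp t A B) (sharp t C D)\<bar> \<le> (1 - t) * \<bar>thompson A C\<bar> + t * \<bar>thompson B D\<bar>"
      using thompson_sharp_le[OF ABCD, of t] t_range ABCD
      by (simp add: thompson_nonneg posinv_sharp)
  qed (use mM t_range in \<open>simp_all add: sharp_in_op_interval sharp_same pos\<close>)
  then show ?thesis
    using mM(1)
    by (intro interval_mean.intro interval_mean_axioms.intro dist_equivalent_metric_axioms)
qed

lemma list_all2_drop_nth: "list_all2 R xs ys \<Longrightarrow> list_all2 R (drop_nth i xs) (drop_nth i ys)"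
  by (simp add: drop_nth_def list_all2_appendI)

lemma list_all2_leave_one_out:
  assumes "length xs = length ys"
    and "\<And>i. i < length xs \<Longrightarrow> R (f (drop_nth i xs)) (g (drop_nth i ys))"
  shows "list_all2 R (leave_one_out f xs) (leave_one_out g ys)"
  using assms by (simp add: leave_one_out_def list_all2_conv_all_nth)

lemma list_all2_iterate_leave_one_out:
  assumes mean: "\<And>xs ys. xs \<in> nlists n S \<Longrightarrow> ys \<in> nlists n T \<Longrightarrow> list_all2 R xs ys \<Longrightarrow> R (f xs) (g ys)"
    and xs: "\<And>r. (leave_one_out f ^^ r) xs \<in> nlists (Suc n) S"
    and ys: "\<And>r. (leave_one_out g ^^ r) ys \<in> nlists (Suc n) T" and "list_all2 R xs ys"
  shows "list_all2 R ((leave_one_out f ^^ r) xs) ((leave_one_out g ^^ r) ys)"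
proof (induction r)
  case (Suc r)
  have "R (f (drop_nth i ((leave_one_out f ^^ r) xs))) (g (drop_nth i ((leave_one_out g ^^ r) ys)))"
    if "i \<le> n" for i
    by (intro mean drop_nth_in_nlists xs ys that list_all2_drop_nth Suc)
  then show ?case
    using nlistsE_length[OF xs, of r] nlistsE_length[OF ys, of r]
    by (simp add: list_all2_leave_one_out)
qed (simp add: assms)

lemma llrec_related:
  assumes left: "interval_mean m M d K base t \<rho>" and right: "interval_mean m M d' K' base' t \<rho>'"
    and base: "\<And>X Y A B. A \<in> op_interval m M \<Longrightarrow> B \<in> op_interval m M \<Longrightarrow>
      R X A \<Longrightarrow> R Y B \<Longrightarrow> R (base t X Y) (base' t A B)"
    and limit: "\<And>X A L G. (\<And>r. A r \<in> op_interval m M) \<Longrightarrow> (\<And>r. R (X r) (A r)) \<Longrightarrow>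
      X \<longlonglongrightarrow> L \<Longrightarrow> A \<longlonglongrightarrow> G \<Longrightarrow> R L G"
    and "Xs \<in> nlists (k + 2) (op_interval m M)" "As \<in> nlists (k + 2) (op_interval m M)"
      "list_all2 R Xs As"
  shows "R (llrec base t k Xs) (llrec base' t k As)"
proof -
  interpret left: interval_mean m M d K base t \<rho> by fact
  interpret right: interval_mean m M d' K' base' t \<rho>' by fact
  show ?thesis
    using assms(5-)
  proof (induction k arbitrary: Xs As)
    case 0
    then have "R (Xs ! 0) (As ! 0)" "R (Xs ! 1) (As ! 1)"
      using list_all2_nthD[OF 0(3), of 0] list_all2_nthD[OF 0(3), of 1] by simp_all
    then show ?case using 0 by (auto intro!: base nlistsE_nth_in)
  next
    case (Suc k)
    then have Xs: "Xs \<in> nlists (Suc (k + 2)) (op_interval m M)"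
      and As: "As \<in> nlists (Suc (k + 2)) (op_interval m M)"
      by simp_all
    have related: "list_all2 R (left.iterate k r Xs) (right.iterate k r As)" for r
      by (rule list_all2_iterate_leave_one_out[OF Suc.IH left.iterate_in[OF Xs]
            right.iterate_in[OF As] Suc.prems(3)])
    show ?case
    proof (rule limit)
      show "right.iterate k r As ! 0 \<in> op_interval m M" for r
        using nlistsE_nth_in[OF right.iterate_in[OF As]] by simp
      show "R (left.iterate k r Xs ! 0) (right.iterate k r As ! 0)" for r
        using list_all2_nthD[OF related, of 0 r] nlistsE_length[OF left.iterate_in[OF Xs]] by simp
      show "(\<lambda>r. left.iterate k r Xs ! 0) \<longlonglongrightarrow> llrec base t (Suc k) Xs"
        by (rule left.iterate_LIMSEQ[OF Xs]) simp
      show "(\<lambda>r. right.iterate k r As ! 0) \<longlonglongrightarrow> llrec base' t (Suc k) As"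
        by (rule right.iterate_LIMSEQ[OF As]) simp
    qed
  qed
qed

subsection \<open>The Kantorovich-type inequality\<close>

definition kantorovich :: "real \<Rightarrow> real \<Rightarrow> 'a::{real_inner,complete_space} op \<Rightarrow> 'a op \<Rightarrow> bool" where
  "kantorovich m M X A \<longleftrightarrow> loewner (X + (m * M) *\<^sub>R opow A (-1)) ((m + M) *\<^sub>R id_blinfun)"

lemma kantorovich_refl:
  assumes A: "A \<in> op_interval m M" and m_pos: "0 < m"
  shows "kantorovich m M A A"
proof -
  note powr = continuous_on_powr_Icc[OF m_pos]
  note inv = continuous_on_mult_left[OF powr[of M "-1"], of "m * M"]
  have "loewner (cfun (\<lambda>x. x + (m * M) * x powr (-1)) A) (cfun (\<lambda>x. m + M) A)"
  proof (rule cfun_mono[OF A continuous_on_add[OF continuous_on_id inv] continuous_on_const])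
    fix x assume x: "x \<in> {m..M}"
    then have "(x - m) * (x - M) \<le> 0" by (simp add: mult_nonneg_nonpos)
    then have "x * x + m * M \<le> (m + M) * x" by (simp add: algebra_simps)
    then show "x + (m * M) * x powr (-1) \<le> m + M"
      using x m_pos by (simp add: powr_minus field_simps)
  qed
  also have "cfun (\<lambda>x. x + (m * M) * x powr (-1)) A = A + (m * M) *\<^sub>R opow A (-1)"
    by (simp only: cfun_add[OF A continuous_on_id inv] cfun_mult_left[OF A powr]
        cfun_ident[OF A] opow_def)
  finally show ?thesis by (simp add: kantorovich_def cfun_const[OF A])
qed

lemma kantorovich_wam2_sharp:
  assumes A: "posinv A" and B: "posinv B" and XA: "kantorovich m M X A"
    and YB: "kantorovich m M Y B"
    and t_range: "0 \<le> t" "t \<le> 1" and "0 \<le> m * M"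
  shows "kantorovich m M (wam2 t X Y) (sharp t A B)"
proof -
  have "loewner (opow (sharp t A B) (-1)) (wam2 t (opow A (-1)) (opow B (-1)))"
    unfolding opow_minus_one_sharp[OF A B] by (intro sharp_le_wam2 posinv_opow A B t_range)
  then have "loewner (wam2 t X Y + (m * M) *\<^sub>R opow (sharp t A B) (-1))
      (wam2 t X Y + (m * M) *\<^sub>R wam2 t (opow A (-1)) (opow B (-1)))"
    using \<open>0 \<le> m * M\<close> by (intro loewner_add loewner_scaleR loewner_refl)
  also have "wam2 t X Y + (m * M) *\<^sub>R wam2 t (opow A (-1)) (opow B (-1))
      = wam2 t (X + (m * M) *\<^sub>R opow A (-1)) (Y + (m * M) *\<^sub>R opow B (-1))"
    by (simp add: wam2_def scaleR_add_right mult.commute)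
  also have "loewner \<dots> (wam2 t ((m + M) *\<^sub>R id_blinfun) ((m + M) *\<^sub>R id_blinfun))"
    using XA YB t_range by (intro wam2_mono) (simp_all add: kantorovich_def)
  finally show ?thesis by (simp add: kantorovich_def wam2_same)
qed

lemma kantorovich_limit:
  assumes A: "\<And>r. A r \<in> op_interval m M" and m_pos: "0 < m"
    and XA: "\<And>r. kantorovich m M (X r) (A r)"
    and X_lim: "X \<longlonglongrightarrow> L" and A_lim: "A \<longlonglongrightarrow> G"
  shows "kantorovich m M L G"
proof -
  have "(\<lambda>r. opow (A r) (-1)) \<longlonglongrightarrow> opow G (-1)"
    by (rule continuous_on_tendsto_compose[OF continuous_on_opow[OF m_pos] A_lim
          op_interval_limit[OF A A_lim]])
      (simp add: A)
  then have "(\<lambda>r. X r + (m * M) *\<^sub>R opow (A r) (-1)) \<longlonglongrightarrow> L + (m * M) *\<^sub>R opow G (-1)"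
    by (intro tendsto_intros X_lim)
  then show ?thesis
    unfolding kantorovich_def
    by (rule loewner_limit[OF XA[unfolded kantorovich_def] _ tendsto_const])
qed

lemma kantorovich_llrec:
  assumes mM: "0 < m" "m \<le> M" and t_range: "0 < t" "t < 1"
    and As: "As \<in> nlists (k + 2) (op_interval m M)"
  shows "kantorovich m M (llrec wam2 t k As) (llrec sharp t k As)"
proof (rule llrec_related[OF interval_mean_wam2[OF mM(1) t_range]
      interval_mean_sharp[OF mM t_range] _ _ As As])
  show "kantorovich m M (wam2 t X Y) (sharp t A B)"
    if "A \<in> op_interval m M" "B \<in> op_interval m M" "kantorovich m M X A"
      "kantorovich m M Y B" for X Y A B
    using mM t_range
    by (intro kantorovich_wam2_sharp that(3,4)
        that(1,2)[THEN op_interval_posinv[OF _ mM(1)]]) simp_all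
  show "list_all2 (kantorovich m M) As As"
    using kantorovich_refl[OF _ mM(1)] nlistsE_set[OF As] by (auto simp: list_all2_same)
qed (rule kantorovich_limit[OF _ mM(1)])

lemma four_product_le_of_sum_le:
  fixes \<alpha> \<beta> k c :: real
  assumes "0 \<le> \<alpha>" "0 \<le> \<beta>" "0 \<le> k" and "(\<alpha> + \<beta>) * (1 + k) \<le> 2 * c"
  shows "\<alpha> * \<beta> * k \<le> c\<^sup>2 / 4"
proof -
  have "(4 * (\<alpha> * \<beta>)) * (4 * k) \<le> (\<alpha> + \<beta>)\<^sup>2 * (1 + k)\<^sup>2"
    using assms sum_squares_bound[of \<alpha> \<beta>] sum_squares_bound[of 1 k]
    by (intro mult_mono) (simp_all add: power2_sum)
  also have "\<dots> \<le> (2 * c)\<^sup>2"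
    unfolding power_mult_distrib[symmetric] using assms by (intro power_mono) simp_all
  finally show ?thesis by (simp add: power_mult_distrib)
qed

lemma positive_op_form_ge_rank_one:
  assumes S: "positive_op S" and "z \<noteq> 0" "0 < \<gamma>" and Sz: "S z = (\<gamma> * norm z) *\<^sub>R e" and "norm e = 1"
  shows "\<gamma> * (e \<bullet> w)\<^sup>2 \<le> S w \<bullet> w"
proof -
  have "(S z \<bullet> w)\<^sup>2 \<le> (S z \<bullet> z) * (S w \<bullet> w)" by (rule positive_op_Cauchy_Schwarz[OF S])
  also have "\<dots> \<le> (norm (S z) * norm z) * (S w \<bullet> w)"
    by (intro mult_right_mono norm_cauchy_schwarz positive_opD[OF S])
  finally have "(\<gamma> * (norm z)\<^sup>2) * (\<gamma> * (e \<bullet> w)\<^sup>2) \<le> (\<gamma> * (norm z)\<^sup>2) * (S w \<bullet> w)"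
    using \<open>0 < \<gamma>\<close> \<open>norm e = 1\<close> unfolding Sz by (simp add: power2_eq_square mult_ac)
  then show ?thesis using \<open>z \<noteq> 0\<close> \<open>0 < \<gamma>\<close> by simp
qed

text \<open>Bhatia--Kittaneh: with \<open>u\<close> and \<open>v\<close> the directions of \<open>Q x\<close> and \<open>P y\<close> and \<open>k = u \<bullet> v\<close>, the rank-one
  minorants of \<open>Q\<close> at \<open>x\<close> and of \<open>P\<close> at \<open>y\<close> are tested on the bisector \<open>u + v\<close>.\<close>

lemma positive_op_inner_le:
  assumes P: "positive_op P" and Q: "positive_op Q" and PQ_le: "loewner (P + Q) (c *\<^sub>R id_blinfun)"
  shows "Q x \<bullet> P y \<le> c\<^sup>2 / 4 * (norm x * norm y)"
proof (cases "Q x \<bullet> P y \<le> 0")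
  case True
  moreover have "0 \<le> c\<^sup>2 / 4 * (norm x * norm y)" by simp
  ultimately show ?thesis by linarith
next
  case False
  define u v w k where "u = sgn (Q x)" and "v = sgn (P y)" and "w = u + v" and "k = u \<bullet> v"
  define \<alpha> \<beta> where "\<alpha> = norm (Q x) / norm x" and "\<beta> = norm (P y) / norm y"
  have nonzero: "Q x \<noteq> 0" "P y \<noteq> 0" "x \<noteq> 0" "y \<noteq> 0" using False by (auto simp: blinfun.zero_right)
  then have unit: "norm u = 1" "norm v = 1" by (simp_all add: u_def v_def norm_sgn)
  have Qx: "Q x = (\<alpha> * norm x) *\<^sub>R u" and Py: "P y = (\<beta> * norm y) *\<^sub>R v"
    using nonzero by (simp_all add: u_def v_def \<alpha>_def \<beta>_def sgn_div_norm)
  have product: "Q x \<bullet> P y = \<alpha> * \<beta> * k * (norm x * norm y)"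
    unfolding Qx Py by (simp add: k_def)
  have "0 < \<alpha>" "0 < \<beta>" using nonzero by (simp_all add: \<alpha>_def \<beta>_def)
  have "0 < (\<alpha> * \<beta> * (norm x * norm y)) * k" using False unfolding product by (simp add: mult_ac)
  then have "0 < k" by (rule zero_less_mult_pos) (use nonzero \<open>0 < \<alpha>\<close> \<open>0 < \<beta>\<close> in simp)
  have "u \<bullet> w = 1 + k" "v \<bullet> w = 1 + k" and w_sq: "w \<bullet> w = 2 * (1 + k)"
    using unit by (simp_all add: w_def k_def inner_simps inner_commute[of v u] norm_eq_1)
  then have "\<alpha> * (1 + k)\<^sup>2 \<le> Q w \<bullet> w" "\<beta> * (1 + k)\<^sup>2 \<le> P w \<bullet> w"
    using positive_op_form_ge_rank_one[OF Q _ \<open>0 < \<alpha>\<close> Qx, of w]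
      positive_op_form_ge_rank_one[OF P _ \<open>0 < \<beta>\<close> Py, of w] nonzero unit by simp_all
  moreover have "P w \<bullet> w + Q w \<bullet> w \<le> c * (2 * (1 + k))"
    using loewnerD[OF PQ_le, of w] w_sq
    by (simp add: blinfun.add_left blinfun.scaleR_left inner_add_left)
  ultimately have "\<alpha> * (1 + k)\<^sup>2 + \<beta> * (1 + k)\<^sup>2 \<le> c * (2 * (1 + k))" by linarith
  then have "(\<alpha> + \<beta>) * (1 + k) * (1 + k) \<le> (2 * c) * (1 + k)"
    by (simp add: power2_eq_square algebra_simps)
  then have "(\<alpha> + \<beta>) * (1 + k) \<le> 2 * c" using \<open>0 < k\<close> by simp
  then have "\<alpha> * \<beta> * k \<le> c\<^sup>2 / 4"
    using \<open>0 < \<alpha>\<close> \<open>0 < \<beta>\<close> \<open>0 < k\<close> by (intro four_product_le_of_sum_le) simp_all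
  then show ?thesis unfolding product by (rule mult_right_mono) simp
qed

lemma norm_compose_positive_le:
  assumes P: "positive_op P" and "positive_op Q" and "loewner (P + Q) (c *\<^sub>R id_blinfun)"
  shows "norm (P o\<^sub>L Q) \<le> c\<^sup>2 / 4"
proof (rule norm_blinfun_bound)
  fix x
  let ?y = "P (Q x)"
  show "norm ((P o\<^sub>L Q) x) \<le> c\<^sup>2 / 4 * norm x"
  proof (cases "?y = 0")
    case False
    have "norm ?y * norm ?y = Q x \<bullet> P ?y"
      using self_adjointD[OF positive_opD(1)[OF P], of "Q x" ?y]
      by (simp add: dot_square_norm power2_eq_square)
    also have "\<dots> \<le> (c\<^sup>2 / 4 * norm x) * norm ?y"
      using positive_op_inner_le[OF assms, of x ?y] by (simp add: mult.assoc)
    finally show ?thesis using False by simp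
  qed simp
qed simp

lemma opow_le_scaleR:
  assumes X: "X \<in> op_interval a b" and a_pos: "0 < a" and "b \<le> c" and s_ge_1: "1 \<le> s"
  shows "loewner (opow X s) (c powr (s - 1) *\<^sub>R X)"
proof -
  have "loewner (opow X s) (cfun (\<lambda>x. c powr (s - 1) * x) X)"
    unfolding opow_def
  proof (rule cfun_mono[OF X continuous_on_powr_Icc[OF a_pos]])
    fix x assume x: "x \<in> {a..b}"
    have "x powr s = x powr (s - 1) * x powr 1" unfolding powr_add[symmetric] by simp
    also have "\<dots> \<le> c powr (s - 1) * x"
      using x a_pos \<open>b \<le> c\<close> s_ge_1 by (simp add: mult_right_mono powr_mono2)
    finally show "x powr s \<le> c powr (s - 1) * x" .
  qed (intro continuous_intros)
  then show ?thesis
    using cfun_mult_left[OF X continuous_on_id, of "c powr (s - 1)"] by (simp add: cfun_ident[OF X])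
qed

lemma opow_sum_le_of_kantorovich:
  assumes X: "X \<in> op_interval m M" and G: "G \<in> op_interval m M" and mM: "0 < m" "m \<le> M"
    and kant: "kantorovich m M X G" and s_ge_1: "1 \<le> s"
  shows "loewner (opow X s + (m * M) powr s *\<^sub>R opow G (- s)) ((m + M) powr s *\<^sub>R id_blinfun)"
proof -
  let ?c = "m + M" and ?H = "(m * M) *\<^sub>R opow G (-1)"
  note pos_G = op_interval_posinv[OF G mM(1)]
  have H: "?H \<in> op_interval m M"
    using op_interval_scaleR[OF opow_minus_one_in_op_interval[OF G mM(1)], of "m * M"] mM by simp
  have "(m * M) powr s *\<^sub>R opow G (- s) = opow ?H s"
    using opow_scaleR[OF posinv_opow[OF pos_G], of "m * M" "-1" s] mM
    by (simp add: opow_opow[OF pos_G])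
  then have "loewner (opow X s + (m * M) powr s *\<^sub>R opow G (- s))
      (?c powr (s - 1) *\<^sub>R X + ?c powr (s - 1) *\<^sub>R ?H)"
    using mM s_ge_1
        loewner_add[OF opow_le_scaleR[OF X mM(1)] opow_le_scaleR[OF H mM(1)], of ?c s ?c s]
    by simp
  also have "?c powr (s - 1) *\<^sub>R X + ?c powr (s - 1) *\<^sub>R ?H = ?c powr (s - 1) *\<^sub>R (X + ?H)"
    by (simp only: scaleR_add_right)
  also have "loewner \<dots> (?c powr (s - 1) *\<^sub>R (?c *\<^sub>R id_blinfun))"
    using kant by (intro loewner_scaleR) (simp_all add: kantorovich_def)
  also have "?c powr (s - 1) *\<^sub>R (?c *\<^sub>R id_blinfun) = ?c powr s *\<^sub>R (id_blinfun :: 'a op)"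
    using powr_add[of ?c "s - 1" 1] mM by simp
  finally show ?thesis .
qed

lemma loewner_opow_of_norm_quotient_le:
  assumes X: "posinv X" and G: "posinv G"
    and quotient_le: "norm (opow X (p / 2) o\<^sub>L opow G (- (p / 2))) \<le> c"
  shows "loewner (opow X p) (c\<^sup>2 *\<^sub>R opow G p)"
proof (rule loewnerI)
  fix x
  let ?z = "opow G (p / 2) x"
  have "norm (opow X (p / 2) x) = norm ((opow X (p / 2) o\<^sub>L opow G (- (p / 2))) ?z)"
    by (simp add: opow_apply_inverse[OF G])
  also have "\<dots> \<le> norm (opow X (p / 2) o\<^sub>L opow G (- (p / 2))) * norm ?z" by (rule norm_blinfun)
  also have "\<dots> \<le> c * norm ?z" using quotient_le by (rule mult_right_mono) simp
  finally have "(norm (opow X (p / 2) x))\<^sup>2 \<le> (c * norm ?z)\<^sup>2" by (rule power_mono) simp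
  then show "opow X p x \<bullet> x \<le> (c\<^sup>2 *\<^sub>R opow G p) x \<bullet> x"
    by (simp add: norm_opow_half X G power_mult_distrib blinfun.bilinear_simps)
qed (simp_all add: self_adjoint_opow X G)

lemma loewner_opow_of_kantorovich:
  assumes X: "X \<in> op_interval m M" and G: "G \<in> op_interval m M" and mM: "0 < m" "m \<le> M"
    and kant: "kantorovich m M X G" and p_ge_2: "2 \<le> p"
  shows "loewner (opow X p) (((m + M) powr (2 * p) / (16 * m powr p * M powr p)) *\<^sub>R opow G p)"
proof -
  note pos_X = op_interval_posinv[OF X mM(1)] and pos_G = op_interval_posinv[OF G mM(1)]
  define s where "s = p / 2"
  define c where "c = (m * M) powr s"
  have "0 < c" using mM by (simp add: c_def)
  have "norm (opow X s o\<^sub>L (c *\<^sub>R opow G (- s))) \<le> ((m + M) powr s)\<^sup>2 / 4"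
  proof (rule norm_compose_positive_le)
    show "loewner (opow X s + c *\<^sub>R opow G (- s)) ((m + M) powr s *\<^sub>R id_blinfun)"
      unfolding c_def
      by (rule opow_sum_le_of_kantorovich[OF X G mM kant]) (use p_ge_2 in \<open>simp add: s_def\<close>)
  qed (intro posinv_positive posinv_scaleR posinv_opow pos_X pos_G \<open>0 < c\<close>)+
  then have "norm (opow X s o\<^sub>L opow G (- s)) \<le> ((m + M) powr s)\<^sup>2 / 4 / c"
    using \<open>0 < c\<close> by (simp add: blinfun_compose.bilinear_simps pos_le_divide_eq mult.commute)
  then have "loewner (opow X p) ((((m + M) powr s)\<^sup>2 / 4 / c)\<^sup>2 *\<^sub>R opow G p)"
    unfolding s_def by (rule loewner_opow_of_norm_quotient_le[OF pos_X pos_G])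
  moreover have square: "(y powr s)\<^sup>2 = y powr p" if "0 < y" for y :: real
    using that by (simp add: s_def power2_eq_square powr_add[symmetric])
  then have "(((m + M) powr s)\<^sup>2 / 4 / c)\<^sup>2 = (m + M) powr (2 * p) / (16 * m powr p * M powr p)"
    using mM
    by (simp add: c_def power_divide powr_mult power_mult_distrib square powr_add[symmetric]
        power2_eq_square[of "(m + M) powr p"])
  ultimately show ?thesis by simp
qed

theorem theorem4p1:
  fixes As :: "('a::{real_inner,complete_space} \<Rightarrow>\<^sub>L 'a) list"
    and t m M p :: real
  assumes "length As \<ge> 2"
    and "0 < t" and "t < 1"
    and "0 < m" and "m < M"
    and "\<forall>A\<in>set As. posinv A \<and> loewner (m *\<^sub>R id_blinfun) A \<and> loewner A (M *\<^sub>R id_blinfun)"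
    and "p \<ge> 2"
  shows "loewner (opow (AM t As) p)
           (((m + M) powr (2 * p) / (16 * m powr p * M powr p)) *\<^sub>R opow (GM t As) p)"
proof -
  have mM: "0 < m" "m \<le> M" and t_range: "0 < t" "t < 1" using assms by simp_all
  define k where "k = length As - 2"
  have As: "As \<in> nlists (k + 2) (op_interval m M)"
    using assms(1,6) by (auto simp: k_def op_interval_def intro!: nlistsI)
  have "AM t As \<in> op_interval m M"
    unfolding AM_def k_def[symmetric]
    by (rule interval_mean.llrec_in[OF interval_mean_wam2[OF mM(1) t_range] As])
  moreover have "GM t As \<in> op_interval m M"
    unfolding GM_def k_def[symmetric]
    by (rule interval_mean.llrec_in[OF interval_mean_sharp[OF mM t_range] As])
  moreover have "kantorovich m M (AM t As) (GM t As)"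
    unfolding AM_def GM_def k_def[symmetric] by (rule kantorovich_llrec[OF mM t_range As])
  ultimately show ?thesis using mM \<open>p \<ge> 2\<close> by (intro loewner_opow_of_kantorovich)
qed

end
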